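(* For all $m \ge 1$, as formal power series in $x$ with coefficients polynomials in $t$, $$\sum_{n\geq 1}\chi_{\mathcal L(\mathcal H^m_{2n-1})}(t)\, x^n = \sum_{n\geq 1}\frac{(t-1)_{n,m}\,(t-m)_{n-1,m}\,x^n}{\prod_{k=1}^n\bigl(1-mk(t-mk)x\bigr)},$$ where $(a)_{n,m} = a(a-m)(a-2m)\cdots(a-(n-1)m)$ (with $(a)_{0,m}=1$) and, with $\omega=e^{2\pi i/m}$, $\mathcal H^m_{2n-1}$ is the complex arrangement in $\mathbb C^{2n}$ given by $\{x_i - \omega^{\ell}x_j = y_i : 1\leq i < j \leq n,\ 0\leq \ell < m\} \cup \{x_i = y_i : 1\le i \le n\}$.
   Context: $\mathcal L(\mathcal A)$ is the intersection lattice of an arrangement (nonempty intersections of its hyperplanes ordered by reverse inclusion). For a finite ranked poset $P$ of length $r$ with minimum $\hat 0$, $\chi_P(t)=\sum_{x\in P}\mu_P(\hat0,x)t^{r-\mathrm{rk}(x)}$. *)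

theory Defs
  imports
    Complex_Main
    "HOL-Library.FuncSet"
    "HOL-Computational_Algebra.Polynomial"
    "HOL-Computational_Algebra.Formal_Power_Series"
begin

text \<open>
  A poset is a carrier \<open>A\<close> with a relation \<open>r\<close> satisfying \<^const>\<open>partial_order_on\<close> on \<open>A\<close>;
  \<open>(x, y) \<in> r\<close> means \<open>x \<le> y\<close>.
\<close>

text \<open>
  The guards only make the recursion total: the value is the usual Moebius function
  on every finite poset.
\<close>

function poset_moebius :: "'a set \<Rightarrow> 'a rel \<Rightarrow> 'a \<Rightarrow> 'a \<Rightarrow> int" where
  "poset_moebius A r x y =
     (if finite A \<and> partial_order_on A r \<and> (x, y) \<in> r then
        (if x = y then 1
         else - (\<Sum>z\<in>{z \<in> A. (x, z) \<in> r \<and> (z, y) \<in> r \<and> z \<noteq> y}. poset_moebius A r x z))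
      else 0)"
  by pat_completeness auto
termination
proof (relation "Wellfounded.measure (\<lambda>(A, r, x, y). card {z \<in> A. (x, z) \<in> r \<and> (z, y) \<in> r})",
    goal_cases)
  case 1
  then show ?case by simp
next
  case (2 A r x y z)
  then have po: "partial_order_on A r" and fin: "finite A" and xy: "(x, y) \<in> r" by auto
  from 2 have z: "(x, z) \<in> r" "(z, y) \<in> r" "z \<noteq> y" by auto
  have tr: "trans r" and as: "antisym r" and rf: "refl_on A r" and sub: "r \<subseteq> A \<times> A"
    using po by (auto simp: partial_order_on_def preorder_on_def)
  have "{u \<in> A. (x, u) \<in> r \<and> (u, z) \<in> r} \<subset> {u \<in> A. (x, u) \<in> r \<and> (u, y) \<in> r}"
  proof (rule psubsetI)
    show "{u \<in> A. (x, u) \<in> r \<and> (u, z) \<in> r} \<subseteq> {u \<in> A. (x, u) \<in> r \<and> (u, y) \<in> r}"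
      using tr z by (auto dest: transD)
    have "y \<in> {u \<in> A. (x, u) \<in> r \<and> (u, y) \<in> r}"
      using xy sub rf by (auto simp: refl_on_def)
    moreover have "y \<notin> {u \<in> A. (x, u) \<in> r \<and> (u, z) \<in> r}"
      using z as by (auto dest: antisymD)
    ultimately show "{u \<in> A. (x, u) \<in> r \<and> (u, z) \<in> r} \<noteq> {u \<in> A. (x, u) \<in> r \<and> (u, y) \<in> r}"
      by blast
  qed
  then have "card {u \<in> A. (x, u) \<in> r \<and> (u, z) \<in> r} < card {u \<in> A. (x, u) \<in> r \<and> (u, y) \<in> r}"
    using fin by (intro psubset_card_mono) auto
  then show ?case by simp
qed

declare poset_moebius.simps [simp del]

definition poset_bottom :: "'a set \<Rightarrow> 'a rel \<Rightarrow> 'a" where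
  "poset_bottom A r = (THE b. b \<in> A \<and> (\<forall>x\<in>A. (b, x) \<in> r))"

text \<open>The length of a chain is one less than its number of elements.\<close>

definition poset_length :: "'a set \<Rightarrow> 'a rel \<Rightarrow> nat" where
  "poset_length A r = (MAX C\<in>{C \<in> Chains r. C \<subseteq> A}. card C) - 1"

text \<open>
  In a ranked poset with minimum, all maximal chains below \<open>x\<close> have the same length,
  so that the length of the lower interval of \<open>x\<close> is the rank of \<open>x\<close>.
\<close>

definition poset_rank :: "'a set \<Rightarrow> 'a rel \<Rightarrow> 'a \<Rightarrow> nat" where
  "poset_rank A r x = poset_length {y \<in> A. (y, x) \<in> r} r"

definition poset_char_poly :: "'a set \<Rightarrow> 'a rel \<Rightarrow> int poly" where
  "poset_char_poly A r =
     (\<Sum>x\<in>A. monom (poset_moebius A r (poset_bottom A r) x) (poset_length A r - poset_rank A r x))"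

text \<open>
  The empty subfamily contributes the ambient space \<open>V\<close>, which is the minimum
  with respect to reverse inclusion.
\<close>

definition intersection_lattice :: "'a set \<Rightarrow> 'a set set \<Rightarrow> 'a set set" where
  "intersection_lattice V \<A> = {X. X \<noteq> {} \<and> (\<exists>\<B>\<subseteq>\<A>. X = V \<inter> \<Inter>\<B>)}"

definition reverse_inclusion :: "'a set set \<Rightarrow> 'a set rel" where
  "reverse_inclusion L = {(X, Y). X \<in> L \<and> Y \<in> L \<and> Y \<subseteq> X}"

definition arr_char_poly :: "'a set \<Rightarrow> 'a set set \<Rightarrow> int poly" where
  "arr_char_poly V \<A> =
     (let L = intersection_lattice V \<A> in poset_char_poly L (reverse_inclusion L))"

lemma finite_intersection_lattice:
  assumes "finite \<A>"
  shows "finite (intersection_lattice V \<A>)"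
proof -
  have "intersection_lattice V \<A> \<subseteq> (\<lambda>\<B>. V \<inter> \<Inter>\<B>) ` Pow \<A>"
    by (auto simp: intersection_lattice_def)
  then show ?thesis using assms by (meson finite_Pow_iff finite_imageI finite_subset)
qed

lemma partial_order_on_reverse_inclusion: "partial_order_on L (reverse_inclusion L)"
  by (auto simp: partial_order_on_def preorder_on_def refl_on_def reverse_inclusion_def
      intro!: transI antisymI)

text \<open>
  \<open>\<complex>\<^sup>2\<^sup>n\<close> with coordinates \<open>x\<^sub>1, \<dots>, x\<^sub>n, y\<^sub>1, \<dots>, y\<^sub>n\<close>: a point is the pair \<open>(x, y)\<close>
  of extensional functions on \<open>{1..n}\<close>.
\<close>

definition complex_space :: "nat \<Rightarrow> ((nat \<Rightarrow> complex) \<times> (nat \<Rightarrow> complex)) set" where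
  "complex_space n = ({1..n} \<rightarrow>\<^sub>E UNIV) \<times> ({1..n} \<rightarrow>\<^sub>E UNIV)"

definition root_of_unity :: "nat \<Rightarrow> complex" where
  "root_of_unity m = exp (2 * of_real pi * \<i> / of_nat m)"

text \<open>The arrangement \<open>\<H>\<^sup>m\<close> in \<open>\<complex>\<^sup>2\<^sup>n\<close>, conventionally indexed by \<open>2n - 1\<close>.\<close>

definition hom_linial_dowling :: "nat \<Rightarrow> nat \<Rightarrow> ((nat \<Rightarrow> complex) \<times> (nat \<Rightarrow> complex)) set set" where
  "hom_linial_dowling m n =
     {{(x, y) \<in> complex_space n. x i - root_of_unity m ^ l * x j = y i} | i j l.
        1 \<le> i \<and> i < j \<and> j \<le> n \<and> l < m} \<union>
     {{(x, y) \<in> complex_space n. x i = y i} | i. 1 \<le> i \<and> i \<le> n}"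

text \<open>\<open>(a)\<^sub>n\<^sub>,\<^sub>m = a (a - m) \<dots> (a - (n - 1) m)\<close>\<close>

definition step_falling :: "'a::comm_ring_1 \<Rightarrow> nat \<Rightarrow> nat \<Rightarrow> 'a" where
  "step_falling a n m = (\<Prod>i<n. a - of_nat (i * m))"

abbreviation poly_t :: "int poly" where
  "poly_t \<equiv> [:0, 1:]"

text \<open>
  The product is a power series with constant coefficient \<open>1\<close>, so it is invertible over the ring
  \<open>\<int>[t]\<close>; \<^const>\<open>fps_right_inverse\<close> is used because \<^const>\<open>inverse\<close> and division are not
  available for power series over \<^typ>\<open>int poly\<close>.
\<close>

definition rhs_denominator :: "nat \<Rightarrow> nat \<Rightarrow> int poly fps" where
  "rhs_denominator m n =
     (\<Prod>k=1..n. 1 - fps_const (of_nat (m * k) * (poly_t - of_nat (m * k))) * fps_X)"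

definition rhs_term :: "nat \<Rightarrow> nat \<Rightarrow> int poly fps" where
  "rhs_term m n =
     fps_const (step_falling (poly_t - 1) n m * step_falling (poly_t - of_nat m) (n - 1) m)
       * fps_X ^ n * fps_right_inverse (rhs_denominator m n) 1"

lemma rhs_denominator_right_inverse:
  "rhs_denominator m n * fps_right_inverse (rhs_denominator m n) 1 = 1"
proof -
  have "fps_nth (\<Prod>k\<in>K. 1 - fps_const (c k) * fps_X) 0 = (1 :: int poly)" for K :: "nat set" and c
    by (induction K rule: infinite_finite_induct) (auto simp: fps_mult_nth_0)
  then have "fps_nth (rhs_denominator m n) 0 = 1"
    by (simp add: rhs_denominator_def)
  then show ?thesis by (intro fps_right_inverse) simp
qed

end

(*
  Put z_i = x_i - y_i, so that the hyperplanes become z_i = w^l x_j (i < j) and z_i = 0.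
  Take the finite set S of all w^l s with 0 <= s <= k, which has q = mk + 1 elements. Every flat X
  is cut out by equations expressing each coordinate as 0 or a root of unity times a free
  coordinate, so exactly q^(dim X) of its points have all coordinates in S. Moebius inversion
  therefore gives q * chi(q) = the number of points of S^(2n) lying on no hyperplane.
  These points are counted by choosing (x_1, z_1), (x_2, z_2), ... in turn, remembering only the
  number d of moduli used by the z's: x has q - md choices, and z has md choices that keep d and
  q - 1 - md choices that raise it. The coefficients of the right-hand side satisfy the same
  recursion, and the polynomials agree since they agree at all q = mk + 1.
*)

theory Submission
  imports Defs
begin

text \<open>Every equation that occurs reads coordinate = \<open>g\<close> times coordinate with
  \<open>g\<close> zero or a root of unity, and never a sum. Hence a finite set of complex numbers
  containing 0 and stable under the roots of unity can replace the finite field of the usual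
  counting method. The factor q appears because all hyperplanes share a line: x_1 stays free. The
  same factor t turns (t-m)_{d-1,m} into (t)_{d,m}. The series can be read as counting walks on the
  number of used moduli. Staying at level k weighs mk(t-mk), rising from level e weighs
  (t-me)(t-1-me). A walk ending at level d makes every rise from 0 to d-1, which gives
  (t)_{d,m}(t-1)_{d,m} x^d, and the geometric series of the denominator insert the stays. Staying at
  level 0 has weight 0, so the product starts at k = 1. In each pair x comes before z, because z_i
  is compared with x_j only for i < j.\<close>

section \<open>Characteristic polynomials by point counting\<close>

text \<open>\<open>d\<close> stands for the dimension, but only its drop by one under a proper cut
  is assumed, so that the Moebius argument is free of linear algebra. \<open>cut_nonempty\<close>
  makes the arrangement central: all hyperplanes together meet in a flat, the greatest element of
  the lattice.\<close>

locale graded_arrangement =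
  fixes V :: "'a set" and \<A> :: "'a set set" and d :: "'a set \<Rightarrow> nat"
  assumes finite_hyperplanes: "finite \<A>"
    and space_nonempty: "V \<noteq> {}"
    and proper: "H \<in> \<A> \<Longrightarrow> \<not> V \<subseteq> H"
    and cut_nonempty: "\<lbrakk>X \<in> intersection_lattice V \<A>; H \<in> \<A>\<rbrakk> \<Longrightarrow> X \<inter> H \<noteq> {}"
    and cut_dim: "\<lbrakk>X \<in> intersection_lattice V \<A>; H \<in> \<A>; \<not> X \<subseteq> H\<rbrakk> \<Longrightarrow> d X = Suc (d (X \<inter> H))"
begin

abbreviation L where "L \<equiv> intersection_lattice V \<A>"
abbreviation r where "r \<equiv> reverse_inclusion L"

section \<open>Flats, chains and ranks\<close>

lemma finite_L: "finite L"
  using finite_hyperplanes by (rule finite_intersection_lattice)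

lemma V_in_L: "V \<in> L"
  using space_nonempty by (auto simp: intersection_lattice_def intro!: exI[of _ "{}"])

lemma L_subset_V: "X \<in> L \<Longrightarrow> X \<subseteq> V"
  by (auto simp: intersection_lattice_def)

lemma L_cut:
  assumes "X \<in> L" "H \<in> \<A>"
  shows "X \<inter> H \<in> L"
proof -
  from assms obtain \<B> where "\<B> \<subseteq> \<A>" "X = V \<inter> \<Inter>\<B>"
    by (auto simp: intersection_lattice_def)
  then have "insert H \<B> \<subseteq> \<A>" "X \<inter> H = V \<inter> \<Inter>(insert H \<B>)"
    using assms by auto
  then show ?thesis
    using cut_nonempty[OF assms] unfolding intersection_lattice_def by blast
qed

lemma L_Inter:
  assumes "\<B> \<subseteq> \<A>"
  shows "V \<inter> \<Inter>\<B> \<in> L"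
proof -
  have "finite \<B>" using assms finite_hyperplanes finite_subset by blast
  then show ?thesis using assms
  proof (induction \<B> rule: finite_induct)
    case empty
    then show ?case by (simp add: V_in_L)
  next
    case (insert H \<B>)
    then have "V \<inter> \<Inter>\<B> \<in> L" "H \<in> \<A>" by simp_all
    then have "(V \<inter> \<Inter>\<B>) \<inter> H \<in> L" by (rule L_cut)
    moreover have "(V \<inter> \<Inter>\<B>) \<inter> H = V \<inter> \<Inter>(insert H \<B>)" by blast
    ultimately show ?case by simp
  qed
qed

text \<open>Cutting by one hyperplane at a time either changes nothing or lowers \<open>d\<close> by
  one and adds one flat to the chain. The clauses comparing the values of \<open>d\<close> keep the
  truncated subtraction exact and later give strict monotonicity.\<close>

lemma saturated_chain:
  assumes "X \<in> L" "finite \<B>" "\<B> \<subseteq> \<A>"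
  shows "X \<inter> \<Inter>\<B> \<in> L \<and> d (X \<inter> \<Inter>\<B>) \<le> d X \<and> (d (X \<inter> \<Inter>\<B>) = d X \<longrightarrow> X \<inter> \<Inter>\<B> = X) \<and>
    (\<exists>C \<in> Chains r. (\<forall>Y\<in>C. X \<inter> \<Inter>\<B> \<subseteq> Y \<and> Y \<subseteq> X) \<and> card C = Suc (d X - d (X \<inter> \<Inter>\<B>)))"
  using assms(2,3)
proof (induction \<B> rule: finite_induct)
  case empty
  have "{X} \<in> Chains r"
    using assms by (auto simp: Chains_def reverse_inclusion_def)
  then show ?case using assms by (auto intro!: bexI[of _ "{X}"])
next
  case (insert H \<B>)
  let ?Y = "X \<inter> \<Inter>\<B>"
  have eq: "X \<inter> \<Inter>(insert H \<B>) = ?Y \<inter> H" by auto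
  from insert have Y: "?Y \<in> L" "d ?Y \<le> d X" "d ?Y = d X \<longrightarrow> ?Y = X" by auto
  from insert obtain C where C: "C \<in> Chains r" "\<forall>Z\<in>C. ?Y \<subseteq> Z \<and> Z \<subseteq> X" "card C = Suc (d X - d ?Y)"
    by auto
  show ?case
  proof (cases "?Y \<subseteq> H")
    case True
    then have "?Y \<inter> H = ?Y" by auto
    then show ?thesis using insert eq by simp
  next
    case False
    have HA: "H \<in> \<A>" using insert by auto
    have dim: "d ?Y = Suc (d (?Y \<inter> H))" using cut_dim Y HA False by blast
    have YH: "?Y \<inter> H \<in> L" using L_cut Y HA by blast
    have CL: "C \<subseteq> L" using C(1) by (auto simp: Chains_def reverse_inclusion_def)
    have "finite C" using C(3) card.infinite by fastforce
    moreover have "?Y \<inter> H \<notin> C" using C(2) False by blast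
    ultimately have "card (insert (?Y \<inter> H) C) = Suc (d X - d (?Y \<inter> H))"
      using C(3) dim Y(2) by simp
    moreover have "insert (?Y \<inter> H) C \<in> Chains r"
      using C(1,2) YH CL by (auto simp: Chains_def reverse_inclusion_def)
    moreover have "\<forall>Z\<in>insert (?Y \<inter> H) C. ?Y \<inter> H \<subseteq> Z \<and> Z \<subseteq> X" using C(2) by auto
    ultimately show ?thesis using YH dim Y(2) unfolding eq
      by (metis Suc_n_not_le_n le_SucI Suc_leD)
  qed
qed

text \<open>The hyperplanes that cut \<open>Y\<close> out of \<open>V\<close> also cut it out of
  \<open>X\<close>, so \<open>saturated_chain\<close> can start at \<open>X\<close>.\<close>

lemma d_strict_mono:
  assumes "X \<in> L" "Y \<in> L" "Y \<subset> X"
  shows "d Y < d X"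
proof -
  from assms obtain \<B> where \<B>: "\<B> \<subseteq> \<A>" "Y = V \<inter> \<Inter>\<B>"
    by (auto simp: intersection_lattice_def)
  then have "Y = X \<inter> \<Inter>\<B>" using assms L_subset_V by blast
  moreover have "finite \<B>" using \<B> finite_hyperplanes finite_subset by blast
  ultimately have "d Y \<le> d X" "d Y = d X \<longrightarrow> Y = X"
    using saturated_chain[OF assms(1) _ \<B>(1)] by simp_all
  then show ?thesis using assms(3) by (simp add: order_less_le psubset_eq)
qed

text \<open>A saturated chain from \<open>V\<close> down to \<open>X\<close> attains the value; no
  chain is longer, since \<open>d\<close> is injective on it with values between \<open>d X\<close>
  and \<open>d V\<close>.\<close>

lemma rank_eq:
  assumes X: "X \<in> L"
  shows "poset_rank L r X = d V - d X"
proof -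
  let ?I = "{Y \<in> L. (Y, X) \<in> r}"
  let ?\<C> = "{C \<in> Chains r. C \<subseteq> ?I}"
  have fin: "finite ?\<C>"
    by (rule finite_subset[of _ "Pow L"]) (auto simp: finite_L)
  from X obtain \<B> where \<B>: "\<B> \<subseteq> \<A>" "X = V \<inter> \<Inter>\<B>"
    by (auto simp: intersection_lattice_def)
  have "finite \<B>" using \<B> finite_hyperplanes finite_subset by blast
  from saturated_chain[OF V_in_L this \<B>(1)] \<B>(2)
  obtain C where C: "C \<in> Chains r" "\<forall>Y\<in>C. X \<subseteq> Y" "card C = Suc (d V - d X)" and le: "d X \<le> d V"
    by auto
  have "C \<subseteq> ?I" using C X by (auto simp: Chains_def reverse_inclusion_def)
  then have "C \<in> ?\<C>" using C(1) by simp
  from imageI[OF this, of card] have mem: "Suc (d V - d X) \<in> card ` ?\<C>" by (simp only: C(3))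
  have bound: "card C \<le> Suc (d V - d X)" if C: "C \<in> ?\<C>" for C
  proof -
    have CL: "C \<subseteq> L" and CX: "\<And>Y. Y \<in> C \<Longrightarrow> X \<subseteq> Y" using C by (auto simp: reverse_inclusion_def)
    have inj: "inj_on d C"
    proof (rule inj_onI, rule ccontr)
      fix Y Z assume YZ: "Y \<in> C" "Z \<in> C" "d Y = d Z" "Y \<noteq> Z"
      then have "Y \<subset> Z \<or> Z \<subset> Y" using C by (auto simp: Chains_def reverse_inclusion_def)
      then show False using d_strict_mono YZ CL by (metis less_irrefl subsetD)
    qed
    have "d ` C \<subseteq> {d X..d V}"
    proof clarsimp
      fix Y assume Y: "Y \<in> C"
      then have "X \<subseteq> Y" "Y \<in> L" "Y \<subseteq> V" using CX CL L_subset_V by blast+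
      then show "d X \<le> d Y \<and> d Y \<le> d V"
        using d_strict_mono X V_in_L by (metis less_imp_le order.order_iff_strict)
    qed
    then have "card (d ` C) \<le> card {d X..d V}" by (intro card_mono) auto
    then show ?thesis using inj le by (simp add: card_image Suc_diff_le)
  qed
  have "Max (card ` ?\<C>) = Suc (d V - d X)"
    using fin mem bound by (intro Max_eqI) blast+
  then show ?thesis by (simp add: poset_rank_def poset_length_def)
qed

text \<open>The center is the greatest element for reverse inclusion, so its lower interval is the
  whole lattice.\<close>

lemma length_eq: "poset_length L r = d V - d (V \<inter> \<Inter>\<A>)"
proof -
  have "V \<inter> \<Inter>\<A> \<in> L" by (rule L_Inter) simp
  moreover from this have "{Y \<in> L. (Y, V \<inter> \<Inter>\<A>) \<in> r} = L"
    by (auto simp: reverse_inclusion_def intersection_lattice_def)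
  ultimately show ?thesis using rank_eq[of "V \<inter> \<Inter>\<A>"] by (simp add: poset_rank_def)
qed

section \<open>Moebius inversion over the flats\<close>

lemma bottom_eq: "poset_bottom L r = V"
  unfolding poset_bottom_def
proof (rule the_equality)
  show "V \<in> L \<and> (\<forall>X\<in>L. (V, X) \<in> r)"
    using V_in_L L_subset_V by (auto simp: reverse_inclusion_def)
  show "b = V" if "b \<in> L \<and> (\<forall>X\<in>L. (b, X) \<in> r)" for b
    using that V_in_L L_subset_V by (auto simp: reverse_inclusion_def)
qed

text \<open>This is the defining recursion with all terms on one side: as \<open>V\<close> is the
  bottom, the interval from \<open>V\<close> to \<open>X\<close> consists of all flats containing
  \<open>X\<close>.\<close>

lemma sum_moebius_le:
  assumes X: "X \<in> L"
  shows "(\<Sum>Y\<in>{Y \<in> L. X \<subseteq> Y}. poset_moebius L r V Y) = (if X = V then 1 else 0)"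
proof -
  let ?B = "{Y \<in> L. (V, Y) \<in> r \<and> (Y, X) \<in> r \<and> Y \<noteq> X}"
  have eq: "{Y \<in> L. X \<subseteq> Y} = insert X ?B"
    using X V_in_L L_subset_V by (auto simp: reverse_inclusion_def)
  have VX: "(V, X) \<in> r" using X V_in_L L_subset_V by (auto simp: reverse_inclusion_def)
  have "(\<Sum>Y\<in>insert X ?B. poset_moebius L r V Y)
      = poset_moebius L r V X + (\<Sum>Y\<in>?B. poset_moebius L r V Y)"
    by (rule sum.insert) (auto simp: finite_L)
  also have "\<dots> = (if X = V then 1 else 0)"
  proof (cases "X = V")
    case True
    then have "?B = {}" using L_subset_V by (auto simp: reverse_inclusion_def)
    then have "(\<Sum>Y\<in>?B. poset_moebius L r V Y) = 0" by (simp only: sum.empty)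
    with True show ?thesis using VX
      by (simp add: poset_moebius.simps[of L r V V] finite_L partial_order_on_reverse_inclusion)
  next
    case False
    then show ?thesis using VX
      by (simp add: poset_moebius.simps[of L r V X] finite_L partial_order_on_reverse_inclusion)
  qed
  finally show ?thesis by (simp only: eq)
qed

text \<open>With \<open>q ^ d X\<close> read as the number of points of \<open>P\<close> on
  \<open>X\<close>, exchanging the sums lets each point collect the Moebius values of all flats
  through it; these cancel unless the point avoids every hyperplane.\<close>

lemma char_poly_count:
  assumes P: "finite P" "P \<subseteq> V"
    and card: "\<And>X. X \<in> L \<Longrightarrow> card (X \<inter> P) = q ^ d X"
  shows "int q ^ d (V \<inter> \<Inter>\<A>) * poly (arr_char_poly V \<A>) (int q) = int (card (P - \<Union>\<A>))"
proof -
  let ?\<mu> = "poset_moebius L r V"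
  let ?T = "V \<inter> \<Inter>\<A>"
  have TL: "?T \<in> L" by (rule L_Inter) simp
  have le: "d X \<le> d Y" if "X \<in> L" "Y \<in> L" "X \<subseteq> Y" for X Y
    using d_strict_mono that by (metis less_imp_le order.order_iff_strict)
  \<comment> \<open>The exponent in the lattice polynomial is the dimension in excess of the center;
    the factor \<open>q ^ d ?T\<close> restores the full dimension.\<close>
  have exponent: "d ?T + (poset_length L r - poset_rank L r X) = d X" if X: "X \<in> L" for X
  proof -
    have "?T \<subseteq> X" using X by (auto simp: intersection_lattice_def)
    then have "d ?T \<le> d X" "d X \<le> d V" using le TL X V_in_L L_subset_V by blast+
    then show ?thesis by (simp add: length_eq rank_eq[OF X])
  qed
  have "int q ^ d ?T * poly (arr_char_poly V \<A>) (int q)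
      = (\<Sum>X\<in>L. int q ^ d ?T * (?\<mu> X * int q ^ (poset_length L r - poset_rank L r X)))"
    by (simp add: arr_char_poly_def poset_char_poly_def Let_def bottom_eq poly_sum poly_monom
        sum_distrib_left)
  also have "\<dots> = (\<Sum>X\<in>L. ?\<mu> X * int q ^ d X)"
    by (rule sum.cong) (simp_all add: exponent[symmetric] power_add mult_ac)
  also have "\<dots> = (\<Sum>X\<in>L. \<Sum>p\<in>P. if p \<in> X then ?\<mu> X else 0)"
  proof (rule sum.cong)
    fix X assume "X \<in> L"
    then have "int q ^ d X = int (card (X \<inter> P))" using card by simp
    then show "?\<mu> X * int q ^ d X = (\<Sum>p\<in>P. if p \<in> X then ?\<mu> X else 0)"
      using P by (simp add: sum.If_cases Int_commute)
  qed simp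
  also have "\<dots> = (\<Sum>p\<in>P. \<Sum>X\<in>L. if p \<in> X then ?\<mu> X else 0)" by (rule sum.swap)
  also have "\<dots> = (\<Sum>p\<in>P. if p \<in> P - \<Union>\<A> then 1 else 0)"
  proof (rule sum.cong)
    fix p assume p: "p \<in> P"
    \<comment> \<open>The smallest flat through \<open>p\<close>: a flat contains \<open>p\<close>
      exactly when it contains \<open>?F\<close>.\<close>
    let ?F = "V \<inter> \<Inter>{H \<in> \<A>. p \<in> H}"
    have FL: "?F \<in> L" by (rule L_Inter) auto
    have "X \<in> L \<Longrightarrow> p \<in> X \<longleftrightarrow> ?F \<subseteq> X" for X
      using p P by (auto simp: intersection_lattice_def)
    then have "(\<Sum>X\<in>L. if p \<in> X then ?\<mu> X else 0) = (\<Sum>X\<in>{X \<in> L. ?F \<subseteq> X}. ?\<mu> X)"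
      by (auto simp: finite_L sum.inter_filter intro!: sum.cong)
    also have "\<dots> = (if ?F = V then 1 else 0)" by (rule sum_moebius_le[OF FL])
    also have "?F = V \<longleftrightarrow> p \<in> P - \<Union>\<A>"
    proof
      assume F: "?F = V"
      have False if H: "H \<in> \<A>" "p \<in> H" for H
      proof -
        have "V \<subseteq> H" using F H by blast
        then show False using proper H by blast
      qed
      then show "p \<in> P - \<Union>\<A>" using p by blast
    qed auto
    finally show "(\<Sum>X\<in>L. if p \<in> X then ?\<mu> X else 0) = (if p \<in> P - \<Union>\<A> then 1 else 0)" .
  qed simp
  also have "\<dots> = int (card (P - \<Union>\<A>))"
  proof -
    have "P \<inter> {p. p \<in> P - \<Union>\<A>} = P - \<Union>\<A>" by blast
    then show ?thesis using P by (simp add: sum.If_cases del: Diff_iff)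
  qed
  finally show ?thesis .
qed

end

section \<open>Subspaces defined by gain equations\<close>

text \<open>Identifying \<open>V\<close> with functions on \<open>I\<close> suffices, without a
  vector space structure: closure of \<open>G\<close> under products and quotients keeps the class
  of gain equations stable under elimination of a coordinate.\<close>

locale coordinate_space =
  fixes V :: "'a set" and I :: "'i set" and c :: "'a \<Rightarrow> 'i \<Rightarrow> 'f::field" and G :: "'f set"
  assumes finite_I: "finite I"
    and coordinates: "bij_betw (\<lambda>p. restrict (c p) I) V (I \<rightarrow>\<^sub>E UNIV)"
    and finite_G: "finite G"
    and one_G: "1 \<in> G"
    and zero_G: "0 \<notin> G"
    and mult_G: "\<lbrakk>g \<in> G; h \<in> G\<rbrakk> \<Longrightarrow> g * h \<in> G"
    and divide_G: "\<lbrakk>g \<in> G; h \<in> G\<rbrakk> \<Longrightarrow> g / h \<in> G"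
begin

text \<open>
  \<open>R\<close> is the set of free coordinates; the coordinate \<open>e\<close> is \<open>g e\<close> times the free coordinate
  \<open>r e\<close>. Where \<open>g e = 0\<close> the value \<open>r e\<close> is irrelevant, so that \<open>R\<close> may be empty.
\<close>

definition gain_subspace :: "'i set \<Rightarrow> ('i \<Rightarrow> 'i) \<Rightarrow> ('i \<Rightarrow> 'f) \<Rightarrow> 'a set \<Rightarrow> bool" where
  "gain_subspace R r g X \<longleftrightarrow> R \<subseteq> I \<and>
     (\<forall>e\<in>I. g e \<in> insert 0 G \<and> (g e = 0 \<or> r e \<in> R)) \<and> (\<forall>e\<in>R. r e = e \<and> g e = 1) \<and>
     X = {p \<in> V. \<forall>e\<in>I. c p e = g e * c p (r e)}"

definition has_dim :: "'a set \<Rightarrow> nat \<Rightarrow> bool" where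
  "has_dim X k \<longleftrightarrow> (\<exists>R r g. gain_subspace R r g X \<and> card R = k)"

definition gain_hyperplane :: "'a set \<Rightarrow> bool" where
  "gain_hyperplane H \<longleftrightarrow>
     (\<exists>a\<in>I. \<exists>b\<in>I. \<exists>h\<in>insert 0 G. (h = 0 \<or> a \<noteq> b) \<and> H = {p \<in> V. c p a = h * c p b})"

definition grid :: "'f set \<Rightarrow> 'a set" where
  "grid S = {p \<in> V. \<forall>e\<in>I. c p e \<in> S}"

lemma obtain_point:
  obtains p where "p \<in> V" "\<And>e. e \<in> I \<Longrightarrow> c p e = f e"
proof -
  have "restrict f I \<in> (\<lambda>p. restrict (c p) I) ` V"
    using coordinates by (simp add: bij_betw_def)
  then obtain p where p: "p \<in> V" "restrict f I = restrict (c p) I" by auto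
  have "c p e = f e" if "e \<in> I" for e
    using fun_cong[OF p(2), of e] that by simp
  with p(1) show ?thesis by (rule that)
qed

lemma point_eqI:
  assumes "p \<in> V" "q \<in> V" "\<And>e. e \<in> I \<Longrightarrow> c p e = c q e"
  shows "p = q"
proof -
  have "restrict (c p) I = restrict (c q) I" using assms(3) by (rule restrict_ext)
  then show ?thesis using coordinates assms by (auto simp: bij_betw_def dest: inj_onD)
qed

lemma has_dim_V: "has_dim V (card I)"
proof -
  have "gain_subspace I (\<lambda>e. e) (\<lambda>_. 1) V"
    using one_G by (auto simp: gain_subspace_def)
  then show ?thesis unfolding has_dim_def by blast
qed

text \<open>Every coordinate that referred to \<open>u\<close> is redirected to \<open>w\<close>,
  its gain multiplied by \<gamma>; the other coordinates keep their equations.\<close>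

lemma gain_subspace_eliminate:
  assumes X: "gain_subspace R r g X"
    and u: "u \<in> R" and \<gamma>: "\<gamma> \<in> insert 0 G" and w: "\<gamma> = 0 \<or> w \<in> R \<and> w \<noteq> u"
  shows "has_dim {p \<in> X. c p u = \<gamma> * c p w} (card R - 1)"
proof -
  let ?r = "\<lambda>e. if r e = u then w else r e"
  let ?g = "\<lambda>e. if r e = u then g e * \<gamma> else g e"
  from X have R: "R \<subseteq> I" and gG: "\<And>e. e \<in> I \<Longrightarrow> g e \<in> insert 0 G"
    and rR: "\<And>e. e \<in> I \<Longrightarrow> g e = 0 \<or> r e \<in> R"
    and fixR: "\<And>e. e \<in> R \<Longrightarrow> r e = e \<and> g e = 1"
    and Xeq: "X = {p \<in> V. \<forall>e\<in>I. c p e = g e * c p (r e)}"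
    by (auto simp: gain_subspace_def)
  have uI: "u \<in> I" using u R by auto
  have "{p \<in> X. c p u = \<gamma> * c p w} = {p \<in> V. \<forall>e\<in>I. c p e = ?g e * c p (?r e)}"
  proof (intro set_eqI iffI)
    fix p assume "p \<in> {p \<in> X. c p u = \<gamma> * c p w}"
    then have p: "p \<in> V" "\<And>e. e \<in> I \<Longrightarrow> c p e = g e * c p (r e)" "c p u = \<gamma> * c p w"
      by (auto simp: Xeq)
    have "c p e = ?g e * c p (?r e)" if "e \<in> I" for e
      using p(2)[OF that] p(3) by (simp add: mult.assoc)
    then show "p \<in> {p \<in> V. \<forall>e\<in>I. c p e = ?g e * c p (?r e)}" using p(1) by blast
  next
    fix p assume "p \<in> {p \<in> V. \<forall>e\<in>I. c p e = ?g e * c p (?r e)}"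
    then have p: "p \<in> V" "\<And>e. e \<in> I \<Longrightarrow> c p e = ?g e * c p (?r e)" by blast+
    \<comment> \<open>As \<open>u\<close> was free with gain 1, its redirected equation is exactly
      the added one.\<close>
    have pu: "c p u = \<gamma> * c p w" using p(2)[OF uI] fixR[OF u] by simp
    have "c p e = g e * c p (r e)" if "e \<in> I" for e
      using p(2)[OF that] pu by (simp add: mult.assoc split: if_splits)
    then show "p \<in> {p \<in> X. c p u = \<gamma> * c p w}" using p(1) pu by (simp add: Xeq)
  qed
  moreover have "?g e \<in> insert 0 G \<and> (?g e = 0 \<or> ?r e \<in> R - {u})" if "e \<in> I" for e
    using gG[OF that] rR[OF that] \<gamma> w mult_G by auto
  ultimately have "gain_subspace (R - {u}) ?r ?g {p \<in> X. c p u = \<gamma> * c p w}"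
    using R fixR by (auto simp: gain_subspace_def)
  moreover have "card (R - {u}) = card R - 1" using u by (rule card_Diff_singleton)
  ultimately show ?thesis unfolding has_dim_def by blast
qed

text \<open>Both sides of the hyperplane equation are expressed in free coordinates, which leaves
  \<alpha> times coordinate \<open>u\<close> = \<beta> times coordinate \<open>w\<close>. Unless
  this is vacuous on \<open>X\<close>, it can be solved for one free coordinate.\<close>

lemma has_dim_cut:
  assumes X: "has_dim X k" and H: "gain_hyperplane H" and XH: "\<not> X \<subseteq> H"
  obtains k' where "k = Suc k'" "has_dim (X \<inter> H) k'"
proof -
  from X obtain R r g where gs: "gain_subspace R r g X" and k: "card R = k"
    by (auto simp: has_dim_def)
  from H obtain a b h where ab: "a \<in> I" "b \<in> I" and h: "h \<in> insert 0 G"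
    and Heq: "H = {p \<in> V. c p a = h * c p b}"
    unfolding gain_hyperplane_def by blast
  from gs have R: "R \<subseteq> I" and gG: "\<And>e. e \<in> I \<Longrightarrow> g e \<in> insert 0 G"
    and rR: "\<And>e. e \<in> I \<Longrightarrow> g e = 0 \<or> r e \<in> R"
    and Xeq: "X = {p \<in> V. \<forall>e\<in>I. c p e = g e * c p (r e)}"
    by (auto simp: gain_subspace_def)
  define \<alpha> where "\<alpha> = g a"
  define \<beta> where "\<beta> = h * g b"
  define u where "u = r a"
  define w where "w = r b"
  have cut: "X \<inter> H = {p \<in> X. \<alpha> * c p u = \<beta> * c p w}"
    using ab by (auto simp: Xeq Heq \<alpha>_def \<beta>_def u_def w_def mult.assoc)
  have \<alpha>: "\<alpha> \<in> insert 0 G" "\<alpha> = 0 \<or> u \<in> R"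
    using gG ab rR by (auto simp: \<alpha>_def u_def)
  have \<beta>: "\<beta> \<in> insert 0 G" "\<beta> = 0 \<or> w \<in> R"
    using gG ab rR h mult_G by (auto simp: \<beta>_def w_def)
  have reduce: thesis if "v \<in> R" "X \<inter> H = {p \<in> X. c p v = \<gamma> * c p v'}" "\<gamma> \<in> insert 0 G"
    "\<gamma> = 0 \<or> v' \<in> R \<and> v' \<noteq> v" for v v' \<gamma>
  proof -
    have "finite R" using R finite_I by (rule finite_subset)
    with that(1) have "card R > 0" by (auto simp: card_gt_0_iff)
    then have "k = Suc (card R - 1)" using k by simp
    moreover have "has_dim (X \<inter> H) (card R - 1)"
      using gain_subspace_eliminate[OF gs that(1,3,4)] that(2) by simp
    ultimately show thesis by (rule \<open>\<And>k'. k = Suc k' \<Longrightarrow> has_dim (X \<inter> H) k' \<Longrightarrow> thesis\<close>)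
  qed
  have nXH: "X \<inter> H \<noteq> X" using XH by blast
  consider "\<alpha> = 0" "\<beta> = 0" | "\<alpha> = 0" "\<beta> \<noteq> 0" | "\<alpha> \<noteq> 0" "\<beta> = 0"
    | "\<alpha> \<noteq> 0" "\<beta> \<noteq> 0" "u = w" | "\<alpha> \<noteq> 0" "\<beta> \<noteq> 0" "u \<noteq> w"
    by blast
  then show thesis
  proof cases
    case 1
    then show ?thesis using cut nXH by simp
  next
    case 2
    then show ?thesis using cut \<beta> by (intro reduce[of w 0]) auto
  next
    case 3
    then show ?thesis using cut \<alpha> by (intro reduce[of u 0]) auto
  next
    case 4
    \<comment> \<open>Equal gains would make the equation vacuous; different gains force coordinate
      \<open>u\<close> to be 0.\<close>
    then have "\<alpha> \<noteq> \<beta>" using cut nXH by auto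
    then show ?thesis using 4 cut \<alpha> by (intro reduce[of u 0]) auto
  next
    case 5
    then have "\<alpha> * x = \<beta> * y \<longleftrightarrow> x = \<beta> / \<alpha> * y" for x y
      by (auto simp: field_simps)
    moreover have "\<beta> / \<alpha> \<in> G" using 5 \<alpha> \<beta> divide_G by auto
    ultimately show ?thesis using 5 cut \<alpha> \<beta> by (intro reduce[of u "\<beta> / \<alpha>" w]) auto
  qed
qed

text \<open>Free coordinates may be chosen in \<open>S\<close> at will, and the dependent ones,
  being 0 or a gain times an element of \<open>S\<close>, then lie in \<open>S\<close>
  automatically.\<close>

lemma card_Int_grid:
  assumes X: "has_dim X k" and S: "0 \<in> S" and GS: "\<And>g s. \<lbrakk>g \<in> G; s \<in> S\<rbrakk> \<Longrightarrow> g * s \<in> S"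
  shows "card (X \<inter> grid S) = card S ^ k"
proof -
  from X obtain R r g where gs: "gain_subspace R r g X" and k: "card R = k"
    by (auto simp: has_dim_def)
  from gs have R: "R \<subseteq> I" and gG: "\<And>e. e \<in> I \<Longrightarrow> g e \<in> insert 0 G"
    and rR: "\<And>e. e \<in> I \<Longrightarrow> g e = 0 \<or> r e \<in> R"
    and fixR: "\<And>e. e \<in> R \<Longrightarrow> r e = e \<and> g e = 1"
    and Xeq: "X = {p \<in> V. \<forall>e\<in>I. c p e = g e * c p (r e)}"
    by (auto simp: gain_subspace_def)
  have "bij_betw (\<lambda>p. restrict (c p) R) (X \<inter> grid S) (R \<rightarrow>\<^sub>E S)"
  proof (rule bij_betw_imageI)
    show "inj_on (\<lambda>p. restrict (c p) R) (X \<inter> grid S)"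
    proof (rule inj_onI)
      fix p q assume p: "p \<in> X \<inter> grid S" and q: "q \<in> X \<inter> grid S"
        and eq: "restrict (c p) R = restrict (c q) R"
      have eqR: "c p e = c q e" if "e \<in> R" for e using fun_cong[OF eq, of e] that by simp
      show "p = q"
      proof (rule point_eqI)
        fix e assume e: "e \<in> I"
        have "c p e = g e * c p (r e)" "c q e = g e * c q (r e)" using p q e by (auto simp: Xeq)
        then show "c p e = c q e" using rR[OF e] eqR by auto
      qed (use p q in \<open>auto simp: Xeq\<close>)
    qed
    show "(\<lambda>p. restrict (c p) R) ` (X \<inter> grid S) = R \<rightarrow>\<^sub>E S"
    proof (intro equalityI subsetI)
      fix f assume "f \<in> (\<lambda>p. restrict (c p) R) ` (X \<inter> grid S)"
      then show "f \<in> R \<rightarrow>\<^sub>E S" using R by (auto simp: grid_def)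
    next
      fix f assume f: "f \<in> R \<rightarrow>\<^sub>E S"
      obtain p where p: "p \<in> V" "\<And>e. e \<in> I \<Longrightarrow> c p e = g e * f (r e)"
        using obtain_point[of "\<lambda>e. g e * f (r e)"] by blast
      have pR: "c p e = f e" if "e \<in> R" for e
        using p(2)[of e] fixR[OF that] that R by auto
      have "c p e = g e * c p (r e)" if "e \<in> I" for e
        using p(2)[OF that] rR[OF that] pR by auto
      moreover have "c p e \<in> S" if "e \<in> I" for e
        using p(2)[OF that] rR[OF that] gG[OF that] GS S f by auto
      ultimately have "p \<in> X \<inter> grid S" using p(1) by (auto simp: Xeq grid_def)
      moreover have "restrict (c p) R = f"
        using pR f by (intro ext) (auto simp: restrict_def PiE_def extensional_def)
      ultimately show "f \<in> (\<lambda>p. restrict (c p) R) ` (X \<inter> grid S)" by blast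
    qed
  qed
  then have "card (X \<inter> grid S) = card (R \<rightarrow>\<^sub>E S)" by (rule bij_betw_same_card)
  also have "\<dots> = card S ^ k"
    using finite_subset[OF R finite_I] k by (simp add: card_PiE)
  finally show ?thesis .
qed

text \<open>Counting the points with coordinates in \<open>insert 0 G\<close> gives a power of a
  base greater than 1, which determines the exponent.\<close>

lemma has_dim_unique:
  assumes "has_dim X k" "has_dim X l"
  shows "k = l"
proof -
  have S: "0 \<in> insert 0 G" "\<And>g s. \<lbrakk>g \<in> G; s \<in> insert 0 G\<rbrakk> \<Longrightarrow> g * s \<in> insert 0 G"
    using mult_G by auto
  have "card G > 0" using finite_G one_G card_gt_0_iff by blast
  then have "card (insert 0 G) > 1" using zero_G finite_G by simp
  moreover have "card (insert 0 G) ^ k = card (insert 0 G) ^ l"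
    using card_Int_grid[OF assms(1) S] card_Int_grid[OF assms(2) S] by simp
  ultimately show ?thesis using power_inject_exp by blast
qed

text \<open>\<open>has_dim_unique\<close> turns \<open>has_dim\<close> into a function
  \<open>d\<close>, and \<open>has_dim_cut\<close> supplies the axioms of
  \<open>graded_arrangement\<close> about cuts.\<close>

lemma char_poly_grid:
  assumes \<A>: "finite \<A>" "\<And>H. H \<in> \<A> \<Longrightarrow> gain_hyperplane H"
    and k: "has_dim (V \<inter> \<Inter>\<A>) k"
    and S: "finite S" "0 \<in> S" "\<And>g s. \<lbrakk>g \<in> G; s \<in> S\<rbrakk> \<Longrightarrow> g * s \<in> S"
  shows "int (card S) ^ k * poly (arr_char_poly V \<A>) (int (card S)) = int (card (grid S - \<Union>\<A>))"
proof -
  define d where "d X = (THE k. has_dim X k)" for X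
  have d_eq: "d X = k" if "has_dim X k" for X k
    unfolding d_def using that has_dim_unique by blast
  \<comment> \<open>Over \<open>{0}\<close> the count is 1 to the power \<open>k\<close>, so the
    origin lies in \<open>X\<close>.\<close>
  have nonempty: "X \<noteq> {}" if "has_dim X k" for X k
    using card_Int_grid[OF that, of "{0}"] by auto
  have dim_L: "\<exists>k. has_dim X k" if "X \<in> intersection_lattice V \<A>" for X
  proof -
    from that obtain \<B> where \<B>: "\<B> \<subseteq> \<A>" "X = V \<inter> \<Inter>\<B>"
      by (auto simp: intersection_lattice_def)
    have "finite \<B>" using \<B>(1) \<A>(1) finite_subset by blast
    then have "\<exists>k. has_dim (V \<inter> \<Inter>\<B>) k" using \<B>(1)
    proof (induction \<B> rule: finite_induct)
      case empty
      then show ?case using has_dim_V by auto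
    next
      case (insert H \<B>)
      then obtain k where k: "has_dim (V \<inter> \<Inter>\<B>) k" by auto
      have eq: "V \<inter> \<Inter>(insert H \<B>) = (V \<inter> \<Inter>\<B>) \<inter> H" by blast
      have H: "gain_hyperplane H" using insert \<A>(2) by simp
      show ?case
      proof (cases "V \<inter> \<Inter>\<B> \<subseteq> H")
        case True
        then have "V \<inter> \<Inter>(insert H \<B>) = V \<inter> \<Inter>\<B>" by blast
        then show ?thesis using k by auto
      next
        case False
        then obtain k' where "has_dim ((V \<inter> \<Inter>\<B>) \<inter> H) k'" by (rule has_dim_cut[OF k H])
        then show ?thesis unfolding eq by blast
      qed
    qed
    then show ?thesis using \<B>(2) by simp
  qed
  interpret graded_arrangement V \<A> d
  proof
    show "finite \<A>" by (rule \<A>(1))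
    show "V \<noteq> {}" using has_dim_V by (rule nonempty)
    show "\<not> V \<subseteq> H" if "H \<in> \<A>" for H
    proof -
      from \<A>(2)[OF that] obtain a b h where ab: "a \<in> I" "b \<in> I" "h = 0 \<or> a \<noteq> b"
        and H: "H = {p \<in> V. c p a = h * c p b}"
        unfolding gain_hyperplane_def by blast
      \<comment> \<open>This unit point violates the equation: the right side is 0, because either
        the gain is 0 or \<open>b\<close> differs from \<open>a\<close>.\<close>
      obtain p where p: "p \<in> V" "\<And>e. e \<in> I \<Longrightarrow> c p e = (if e = a then 1 else 0)"
        using obtain_point[of "\<lambda>e. if e = a then 1 else 0"] by blast
      have "p \<notin> H" using ab p(2)[of a] p(2)[of b] by (auto simp: H)
      then show ?thesis using p(1) by blast
    qed
    fix X H assume X: "X \<in> intersection_lattice V \<A>" and H: "H \<in> \<A>"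
    obtain k where k: "has_dim X k" using dim_L[OF X] by blast
    show "X \<inter> H \<noteq> {}"
    proof (cases "X \<subseteq> H")
      case True
      then show ?thesis using nonempty[OF k] by blast
    next
      case False
      then obtain k' where "has_dim (X \<inter> H) k'" by (rule has_dim_cut[OF k \<A>(2)[OF H]])
      then show ?thesis by (rule nonempty)
    qed
    show "d X = Suc (d (X \<inter> H))" if "\<not> X \<subseteq> H"
    proof -
      from that obtain k' where "k = Suc k'" "has_dim (X \<inter> H) k'"
        by (rule has_dim_cut[OF k \<A>(2)[OF H]])
      then show ?thesis using d_eq k by simp
    qed
  qed
  have "finite (V \<inter> grid S)"
  proof (rule ccontr)
    assume "infinite (V \<inter> grid S)"
    \<comment> \<open>An infinite set has \<open>card\<close> 0, whereas the count is a power of a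
      positive number.\<close>
    then have "card S ^ card I = 0" using card_Int_grid[OF has_dim_V S(2,3)] by simp
    then show False using S(1,2) by auto
  qed
  moreover have "V \<inter> grid S = grid S" by (auto simp: grid_def)
  ultimately have "finite (grid S)" by simp
  then have "int (card S) ^ d (V \<inter> \<Inter>\<A>) * poly (arr_char_poly V \<A>) (int (card S))
      = int (card (grid S - \<Union>\<A>))"
  proof (rule char_poly_count)
    show "grid S \<subseteq> V" by (auto simp: grid_def)
    show "card (X \<inter> grid S) = card S ^ d X" if "X \<in> L" for X
      using dim_L[OF that] card_Int_grid[OF _ S(2,3)] d_eq by metis
  qed
  then show ?thesis using d_eq[OF k] by simp
qed

end

section \<open>Counting proper colourings\<close>

definition polar_grid :: "nat \<Rightarrow> nat \<Rightarrow> complex set" where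
  "polar_grid m k = (\<lambda>(g, j). g * of_nat j) ` ({g. g ^ m = 1} \<times> {..k})"

text \<open>
  On \<^term>\<open>polar_grid m k\<close>, equality of norms means lying in the same orbit of the \<open>m\<close>-th roots
  of unity.
\<close>

definition proper_colourings ::
    "'b::real_normed_vector set \<Rightarrow> nat \<Rightarrow> ((nat \<Rightarrow> 'b) \<times> (nat \<Rightarrow> 'b)) set" where
  "proper_colourings S n =
     {(x, z) \<in> ({1..n} \<rightarrow>\<^sub>E S) \<times> ({1..n} \<rightarrow>\<^sub>E S - {0}).
        \<forall>i j. 1 \<le> i \<and> i < j \<and> j \<le> n \<longrightarrow> norm (z i) \<noteq> norm (x j)}"

text \<open>
  The number of proper colourings of \<open>{1..n}\<close> in which the values \<open>z\<^sub>i\<close> have exactly \<open>d\<close> moduli, for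
  colours in a set of \<open>q\<close> elements having \<open>m\<close> elements of each nonzero modulus that occurs.
\<close>

primrec colour_weight :: "nat \<Rightarrow> 'a::comm_ring_1 \<Rightarrow> nat \<Rightarrow> nat \<Rightarrow> 'a" where
  "colour_weight m q 0 d = (if d = 0 then 1 else 0)"
| "colour_weight m q (Suc n) d =
     of_nat (m * d) * (q - of_nat (m * d)) * colour_weight m q n d +
     (case d of 0 \<Rightarrow> 0 | Suc e \<Rightarrow>
        (q - of_nat (m * e)) * (q - 1 - of_nat (m * e)) * colour_weight m q n e)"

text \<open>Each new pair raises the number of moduli by at most one.\<close>

lemma colour_weight_eq_0: "n < d \<Longrightarrow> colour_weight m q n d = 0"
  by (induction n arbitrary: d) (auto split: nat.split)

lemma poly_colour_weight: "poly (colour_weight m p n d) a = colour_weight m (poly p a) n d"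
  by (induction n arbitrary: d) (auto split: nat.split)

section \<open>Counting in the polar grid\<close>

lemma norm_root_of_1:
  fixes g :: complex
  assumes "m \<ge> 1" "g ^ m = 1"
  shows "norm g = 1"
proof -
  have "norm g ^ m = 1 ^ m" using assms by (simp add: norm_power[symmetric])
  then show ?thesis using assms(1) by (intro power_eq_imp_eq_base[of _ m 1]) auto
qed

lemma finite_polar_grid: "m \<ge> 1 \<Longrightarrow> finite (polar_grid m k)"
  by (simp add: polar_grid_def finite_roots_unity)

lemma zero_in_polar_grid: "0 \<in> polar_grid m k"
  unfolding polar_grid_def by (rule image_eqI[of _ _ "(1, 0)"]) auto

lemma mult_in_polar_grid:
  assumes "g ^ m = 1" "s \<in> polar_grid m k"
  shows "g * s \<in> polar_grid m k"
proof -
  from assms obtain h j where "h ^ m = 1" "j \<le> k" "s = h * of_nat j"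
    by (auto simp: polar_grid_def)
  then show ?thesis using assms(1) unfolding polar_grid_def
    by (intro image_eqI[of _ _ "(g * h, j)"]) (auto simp: power_mult_distrib)
qed

lemma norm_polar_grid_nonzero:
  "m \<ge> 1 \<Longrightarrow> s \<in> polar_grid m k - {0} \<Longrightarrow> norm s \<in> real ` {1..k}"
  by (auto simp: polar_grid_def norm_mult norm_root_of_1 Suc_le_eq)

text \<open>The norm of \<open>g * of_nat j\<close> is \<open>j\<close>, so equal norms leave only
  the quotient of the two roots of unity. This trades a family of \<open>m\<close> conditions for a
  single one.\<close>

lemma norm_eq_polar_grid_iff:
  assumes m: "m \<ge> 1" and s: "s \<in> polar_grid m k - {0}" and t: "t \<in> polar_grid m k"
  shows "norm s = norm t \<longleftrightarrow> (\<exists>g. g ^ m = 1 \<and> s = g * t)"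
proof
  assume eq: "norm s = norm t"
  from s obtain g j where g: "g ^ m = 1" "s = g * of_nat j" by (auto simp: polar_grid_def)
  from t obtain h i where h: "h ^ m = 1" "t = h * of_nat i" by (auto simp: polar_grid_def)
  have "i = j" using eq g h m by (simp add: norm_mult norm_root_of_1)
  moreover have "h \<noteq> 0" using norm_root_of_1[OF m h(1)] by auto
  ultimately have "s = (g / h) * t" using g h by simp
  moreover have "(g / h) ^ m = 1" using g h by (simp add: power_divide)
  ultimately show "\<exists>g. g ^ m = 1 \<and> s = g * t" by blast
next
  assume "\<exists>g. g ^ m = 1 \<and> s = g * t"
  then show "norm s = norm t" using m by (auto simp: norm_mult norm_root_of_1)
qed

lemma card_polar_grid_norm:
  assumes m: "m \<ge> 1" and T: "T \<subseteq> real ` {1..k}"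
  shows "card {s \<in> polar_grid m k. norm s \<in> T} = m * card T"
proof -
  have "bij_betw (\<lambda>(g, t). g * of_real t) ({g. g ^ m = 1} \<times> T) {s \<in> polar_grid m k. norm s \<in> T}"
  proof (rule bij_betw_imageI)
    show "inj_on (\<lambda>(g, t). g * of_real t :: complex) ({g. g ^ m = 1} \<times> T)"
    proof (rule inj_onI, clarify)
      fix g h :: complex and s t :: real
      assume g: "g ^ m = 1" "h ^ m = 1" and st: "s \<in> T" "t \<in> T"
        and eq: "g * of_real s = h * of_real t"
      \<comment> \<open>Radius 0 must be excluded: there all roots of unity give the same
        point.\<close>
      have pos: "s > 0" "t > 0" using st T by auto
      have "norm (g * of_real s) = norm (h * of_real t)" using eq by simp
      then have "s = t" using g m pos by (simp add: norm_mult norm_root_of_1)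
      then show "g = h \<and> s = t" using eq pos by simp
    qed
    show "(\<lambda>(g, t). g * of_real t) ` ({g. g ^ m = 1} \<times> T) = {s \<in> polar_grid m k. norm s \<in> T}"
    proof (intro equalityI subsetI)
      fix s assume "s \<in> (\<lambda>(g, t). g * of_real t :: complex) ` ({g. g ^ m = 1} \<times> T)"
      then obtain g t where g: "g ^ m = 1" "t \<in> T" "s = g * of_real t" by auto
      moreover obtain j where j: "j \<in> {1..k}" "t = real j" using g(2) T by auto
      ultimately have "s \<in> polar_grid m k"
        unfolding polar_grid_def by (intro image_eqI[of _ _ "(g, j)"]) auto
      moreover have "norm s = t" using g j m by (simp add: norm_mult norm_root_of_1)
      ultimately show "s \<in> {s \<in> polar_grid m k. norm s \<in> T}" using g(2) by simp
    next
      fix s assume s: "s \<in> {s \<in> polar_grid m k. norm s \<in> T}"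
      then obtain g j where g: "g ^ m = 1" "s = g * of_nat j" by (auto simp: polar_grid_def)
      have "norm s = real j" using g m by (simp add: norm_mult norm_root_of_1)
      then show "s \<in> (\<lambda>(g, t). g * of_real t) ` ({g. g ^ m = 1} \<times> T)"
        using g s by (intro image_eqI[of _ _ "(g, real j)"]) auto
    qed
  qed
  then have "card {s \<in> polar_grid m k. norm s \<in> T} = card ({g::complex. g ^ m = 1} \<times> T)"
    by (rule bij_betw_same_card[symmetric])
  then show ?thesis using m by (simp add: card_cartesian_product card_roots_unity_eq)
qed

lemma card_real_image: "card (real ` A) = card A"
  by (rule card_image) (simp add: inj_on_def)

lemma card_polar_grid:
  assumes m: "m \<ge> 1"
  shows "card (polar_grid m k) = m * k + 1"
proof -
  let ?U = "{s \<in> polar_grid m k. norm s \<in> real ` {1..k}}"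
  have "polar_grid m k = insert 0 ?U"
    using norm_polar_grid_nonzero[OF m] zero_in_polar_grid by auto
  moreover have "finite ?U" using finite_polar_grid[OF m] by simp
  moreover have "0 \<notin> ?U" by auto
  ultimately have "card (polar_grid m k) = Suc (card ?U)" by (metis card_insert_disjoint)
  then show ?thesis using card_polar_grid_norm[OF m, of "real ` {1..k}" k]
    by (simp add: card_real_image)
qed

section \<open>Adding one pair of colours at a time\<close>

lemma proper_colourings_0: "proper_colourings S 0 = {(\<lambda>_. undefined, \<lambda>_. undefined)}"
  by (auto simp: proper_colourings_def)

lemma finite_proper_colourings: "finite S \<Longrightarrow> finite (proper_colourings S n)"
  by (rule finite_subset[of _ "({1..n} \<rightarrow>\<^sub>E S) \<times> ({1..n} \<rightarrow>\<^sub>E S - {0})"])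
    (auto simp: proper_colourings_def intro!: finite_PiE)

text \<open>In the last pair, \<open>a\<close> must avoid the norms of all earlier z-values, while
  \<open>b\<close> is any nonzero colour: no condition involves the last z-value, since i <
  j.\<close>

lemma sum_proper_colourings_Suc:
  fixes S :: "'b::real_normed_vector set" and f :: "real set \<Rightarrow> 'c::comm_monoid_add"
  assumes "finite S"
  shows "(\<Sum>(x, z)\<in>proper_colourings S (Suc n). f ((\<lambda>i. norm (z i)) ` {1..Suc n})) =
    (\<Sum>(x, z)\<in>proper_colourings S n.
       \<Sum>(a, b)\<in>{a \<in> S. norm a \<notin> (\<lambda>i. norm (z i)) ` {1..n}} \<times> (S - {0}).
         f (insert (norm b) ((\<lambda>i. norm (z i)) ` {1..n})))"
proof -
  let ?N = "\<lambda>z. (\<lambda>i. norm (z i :: 'b)) ` {1..n}"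
  let ?restr = "\<lambda>(x, z). ((restrict x {1..n}, restrict z {1..n}), (x (Suc n), z (Suc n)))"
  let ?ext = "\<lambda>((x, z), (a, b)). (x(Suc n := a), z(Suc n := b))"
  let ?E = "\<lambda>p. {a \<in> S. norm a \<notin> ?N (snd p)} \<times> (S - {0})"
  have "(\<Sum>p\<in>proper_colourings S n. \<Sum>e\<in>?E p. f (insert (norm (snd e)) (?N (snd p))))
      = (\<Sum>(p, e)\<in>Sigma (proper_colourings S n) ?E. f (insert (norm (snd e)) (?N (snd p))))"
    using assms by (intro sum.Sigma) (auto simp: finite_proper_colourings)
  also have "\<dots> = (\<Sum>p\<in>proper_colourings S (Suc n). f ((\<lambda>i. norm (snd p i)) ` {1..Suc n}))"
  proof (rule sum.reindex_bij_witness[where i = ?restr and j = ?ext])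
    fix e assume e: "e \<in> Sigma (proper_colourings S n) ?E"
    then obtain x z a b where e_eq: "e = ((x, z), (a, b))" by (metis prod.exhaust)
    with e have xz: "(x, z) \<in> proper_colourings S n"
      and ab: "a \<in> S" "norm a \<notin> ?N z" "b \<in> S" "b \<noteq> 0" by auto
    from xz have ext: "x \<in> extensional {1..n}" "z \<in> extensional {1..n}"
      and S: "\<And>i. i \<in> {1..n} \<Longrightarrow> x i \<in> S \<and> z i \<in> S - {0}"
      and ne: "\<And>i j. \<lbrakk>1 \<le> i; i < j; j \<le> n\<rbrakk> \<Longrightarrow> norm (z i) \<noteq> norm (x j)"
      by (auto simp: proper_colourings_def PiE_def)
    show "?restr (?ext e) = e"
      using ext by (auto simp: e_eq restrict_def extensional_def fun_eq_iff)
    have "norm (z i) \<noteq> norm a" if "1 \<le> i" "i \<le> n" for i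
      using ab(2) that by (force simp: image_iff)
    then show "?ext e \<in> proper_colourings S (Suc n)"
      using ext S ne ab
      by (auto simp: e_eq proper_colourings_def PiE_def extensional_def Pi_def le_Suc_eq)
    show "f ((\<lambda>i. norm (snd (?ext e) i)) ` {1..Suc n}) =
        (case e of (p, e) \<Rightarrow> f (insert (norm (snd e)) (?N (snd p))))"
      by (simp add: e_eq atLeastAtMostSuc_conv)
  next
    fix p assume p: "p \<in> proper_colourings S (Suc n)"
    then obtain x z where p_eq: "p = (x, z)" by (metis prod.exhaust)
    from p have ext: "x \<in> extensional {1..Suc n}" "z \<in> extensional {1..Suc n}"
      and S: "\<And>i. i \<in> {1..Suc n} \<Longrightarrow> x i \<in> S \<and> z i \<in> S - {0}"
      and ne: "\<And>i j. \<lbrakk>1 \<le> i; i < j; j \<le> Suc n\<rbrakk> \<Longrightarrow> norm (z i) \<noteq> norm (x j)"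
      by (auto simp: p_eq proper_colourings_def PiE_def)
    show "?ext (?restr p) = p"
      using ext by (auto simp: p_eq restrict_def extensional_def fun_eq_iff)
    have "norm (x (Suc n)) \<notin> ?N z"
      using ne[of _ "Suc n"] by force
    moreover have "?N (restrict z {1..n}) = ?N z" by simp
    ultimately show "?restr p \<in> Sigma (proper_colourings S n) ?E"
      using S ne unfolding p_eq by (auto simp: p_eq proper_colourings_def)
  qed
  finally show ?thesis by (simp add: case_prod_beta)
qed

lemma sum_colour_step:
  assumes m: "m \<ge> 1" and T: "T \<subseteq> real ` {1..k}" and q: "q = int (m * k + 1)"
  shows "(\<Sum>(a, b)\<in>{a \<in> polar_grid m k. norm a \<notin> T} \<times> (polar_grid m k - {0}).
      h (card (insert (norm b) T))) =
    (q - int (m * card T)) *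
      (int (m * card T) * h (card T) + (q - 1 - int (m * card T)) * h (Suc (card T)))"
proof -
  let ?S = "polar_grid m k"
  let ?A = "{b \<in> ?S. norm b \<in> T}" and ?B = "{b \<in> ?S. norm b \<in> real ` {1..k} - T}"
  have finS: "finite ?S" using m by (rule finite_polar_grid)
  have finT: "finite T" using T finite_subset by blast
  have cA: "card ?A = m * card T" using card_polar_grid_norm[OF m T] .
  have cB: "card ?B = m * (k - card T)"
    using card_polar_grid_norm[OF m, of "real ` {1..k} - T" k] T finT
    by (simp add: card_Diff_subset card_real_image)
  have Tk: "card T \<le> k" using card_mono[OF _ T] by (simp add: card_real_image)
  have "{a \<in> ?S. norm a \<notin> T} = ?S - ?A" by auto
  then have cX: "int (card {a \<in> ?S. norm a \<notin> T}) = q - int (m * card T)"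
    using cA Tk finS card_polar_grid[OF m, of k]
    by (simp add: card_Diff_subset q of_nat_diff le_SucI)
  have "?S - {0} = ?A \<union> ?B" using norm_polar_grid_nonzero[OF m] T by fastforce
  then have "(\<Sum>b\<in>?S - {0}. h (card (insert (norm b) T)))
      = (\<Sum>b\<in>?A. h (card (insert (norm b) T))) + (\<Sum>b\<in>?B. h (card (insert (norm b) T)))"
    using finS by (simp add: sum.union_disjoint disjoint_iff)
  also have "(\<Sum>b\<in>?A. h (card (insert (norm b) T))) = (\<Sum>b\<in>?A. h (card T))"
    by (rule sum.cong) (auto simp: insert_absorb)
  also have "(\<Sum>b\<in>?B. h (card (insert (norm b) T))) = (\<Sum>b\<in>?B. h (Suc (card T)))"
    using finT by (intro sum.cong) auto
  finally have "(\<Sum>b\<in>?S - {0}. h (card (insert (norm b) T)))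
      = int (m * card T) * h (card T) + int (m * (k - card T)) * h (Suc (card T))"
    by (simp only: sum_constant cA cB)
  \<comment> \<open>Here \<open>q = m * k + 1\<close> enters: 0 is the one colour outside the
    \<open>k\<close> orbits.\<close>
  moreover have "int (m * (k - card T)) = q - 1 - int (m * card T)"
    using Tk by (simp add: q of_nat_diff algebra_simps)
  ultimately show ?thesis
    by (simp add: sum.cartesian_product[symmetric] cX)
qed

text \<open>The number of colourings alone does not determine the next one. The arbitrary
  \<open>h\<close> records the distribution of the number of moduli, and the induction hypothesis is
  applied to the image of \<open>h\<close> under one step.\<close>

lemma sum_proper_colourings:
  fixes h :: "nat \<Rightarrow> int"
  assumes m: "m \<ge> 1" and q: "q = int (m * k + 1)"
  shows "(\<Sum>(x, z)\<in>proper_colourings (polar_grid m k) n. h (card ((\<lambda>i. norm (z i)) ` {1..n})))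
    = (\<Sum>d\<le>n. colour_weight m q n d * h d)"
proof (induction n arbitrary: h)
  case 0
  then show ?case by (simp add: proper_colourings_0)
next
  case (Suc n)
  let ?S = "polar_grid m k"
  let ?N = "\<lambda>z. (\<lambda>i. norm (z i :: complex)) ` {1..n}"
  let ?s = "\<lambda>d. (q - int (m * d)) * int (m * d)" and ?u = "\<lambda>d. (q - int (m * d)) * (q - 1 - int (m * d))"
  let ?w = "colour_weight m q n"
  have "(\<Sum>(x, z)\<in>proper_colourings ?S (Suc n). h (card ((\<lambda>i. norm (z i)) ` {1..Suc n}))) =
    (\<Sum>(x, z)\<in>proper_colourings ?S n. \<Sum>(a, b)\<in>{a \<in> ?S. norm a \<notin> ?N z} \<times> (?S - {0}).
         h (card (insert (norm b) (?N z))))"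
    by (rule sum_proper_colourings_Suc[OF finite_polar_grid[OF m], where f = "\<lambda>T. h (card T)"])
  also have "\<dots> = (\<Sum>(x, z)\<in>proper_colourings ?S n.
      ?s (card (?N z)) * h (card (?N z)) + ?u (card (?N z)) * h (Suc (card (?N z))))"
  proof (rule sum.cong[OF refl], clarify)
    fix x z assume "(x, z) \<in> proper_colourings ?S n"
    then have "\<And>i. i \<in> {1..n} \<Longrightarrow> z i \<in> ?S - {0}" by (auto simp: proper_colourings_def)
    then have "?N z \<subseteq> real ` {1..k}" using norm_polar_grid_nonzero[OF m] by blast
    then show "(\<Sum>(a, b)\<in>{a \<in> ?S. norm a \<notin> ?N z} \<times> (?S - {0}). h (card (insert (norm b) (?N z)))) =
        ?s (card (?N z)) * h (card (?N z)) + ?u (card (?N z)) * h (Suc (card (?N z)))"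
      by (simp only: sum_colour_step[OF m _ q]) (simp add: algebra_simps)
  qed
  also have "\<dots> = (\<Sum>d\<le>n. ?w d * (?s d * h d + ?u d * h (Suc d)))"
    using Suc.IH[of "\<lambda>d. ?s d * h d + ?u d * h (Suc d)"] .
  also have "\<dots> = (\<Sum>d\<le>n. ?s d * ?w d * h d) + (\<Sum>d\<le>n. ?u d * ?w d * h (Suc d))"
    by (simp add: sum.distrib[symmetric] algebra_simps)
  \<comment> \<open>The added summand at \<open>Suc n\<close> is 0, as \<open>n\<close> pairs cannot
    use \<open>n + 1\<close> moduli.\<close>
  also have "(\<Sum>d\<le>n. ?s d * ?w d * h d) = (\<Sum>d\<le>Suc n. ?s d * ?w d * h d)"
    by (simp add: colour_weight_eq_0)
  also have "(\<Sum>d\<le>n. ?u d * ?w d * h (Suc d))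
      = (\<Sum>d\<le>Suc n. (case d of 0 \<Rightarrow> 0 | Suc e \<Rightarrow> ?u e * ?w e) * h d)"
    by (simp add: sum.atMost_Suc_shift del: sum.atMost_Suc)
  also have "(\<Sum>d\<le>Suc n. ?s d * ?w d * h d) + \<dots> = (\<Sum>d\<le>Suc n. colour_weight m q (Suc n) d * h d)"
    unfolding sum.distrib[symmetric]
    by (rule sum.cong) (auto simp: algebra_simps split: nat.split)
  finally show ?case .
qed

corollary card_proper_colourings:
  assumes "m \<ge> 1"
  shows "int (card (proper_colourings (polar_grid m k) n))
    = (\<Sum>d\<le>n. colour_weight m (int (m * k + 1)) n d)"
  using sum_proper_colourings[OF assms refl, where h = "\<lambda>_. 1"] by (simp add: case_prod_beta)

section \<open>The generating function\<close>

text \<open>In place of a division, the product of denominator \<open>n\<close> and its inverse is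
  inserted as 1, and the factors are regrouped around denominator \<open>Suc n\<close>.\<close>

lemma fps_right_inverse_rhs_denominator_Suc:
  "fps_right_inverse (rhs_denominator m (Suc n)) 1 *
     (1 - fps_const (of_nat (m * Suc n) * (poly_t - of_nat (m * Suc n))) * fps_X) =
   fps_right_inverse (rhs_denominator m n) 1"
proof -
  let ?D = "rhs_denominator m" and ?E = "\<lambda>n. fps_right_inverse (rhs_denominator m n) 1"
  let ?c = "1 - fps_const (of_nat (m * Suc n) * (poly_t - of_nat (m * Suc n))) * fps_X"
  have D: "?D (Suc n) = ?D n * ?c"
    unfolding rhs_denominator_def by (subst prod.nat_ivl_Suc') (simp, rule mult.commute)
  have "?E (Suc n) * ?c = ?E (Suc n) * ?c * (?D n * ?E n)"
    by (simp add: rhs_denominator_right_inverse)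
  also have "\<dots> = ?D (Suc n) * ?E (Suc n) * ?E n"
    by (simp only: D mult_ac)
  finally show ?thesis by (simp add: rhs_denominator_right_inverse)
qed

lemma step_falling_Suc: "step_falling a (Suc n) m = step_falling a n m * (a - of_nat (n * m))"
  by (simp add: step_falling_def)

lemma step_falling_Suc_shift:
  "step_falling a (Suc n) m = a * step_falling (a - of_nat m) n m"
  by (simp add: step_falling_def prod.lessThan_Suc_shift diff_diff_eq distrib_right del: prod.lessThan_Suc)

text \<open>
  For \<open>d \<ge> 1\<close> this is \<open>t\<close> times the \<open>d\<close>-th term of the right-hand side; the factor \<open>t\<close> and the value
  \<open>1\<close> at \<open>d = 0\<close> make the first step of the recursion like all the others.
\<close>

definition weight_series :: "nat \<Rightarrow> nat \<Rightarrow> int poly fps" where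
  "weight_series m d =
     fps_const (step_falling (poly_t - 1) d m * step_falling poly_t d m) * fps_X ^ d *
       fps_right_inverse (rhs_denominator m d) 1"

text \<open>Clearing the last denominator factor leaves the series on both sides, but on the right
  with a factor \<open>fps_X\<close>; comparing coefficients thus gives a recursion in the
  exponent.\<close>

lemma weight_series_Suc:
  "weight_series m (Suc d) =
     fps_const (of_nat (m * Suc d) * (poly_t - of_nat (m * Suc d))) * fps_X * weight_series m (Suc d) +
     fps_const ((poly_t - of_nat (m * d)) * (poly_t - 1 - of_nat (m * d))) * fps_X * weight_series m d"
proof -
  let ?a = "fps_const (of_nat (m * Suc d) * (poly_t - of_nat (m * Suc d)))"
  let ?u = "(poly_t - of_nat (m * d)) * (poly_t - 1 - of_nat (m * d))"
  let ?c = "\<lambda>d. step_falling (poly_t - 1) d m * step_falling poly_t d m"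
  let ?E = "\<lambda>d. fps_right_inverse (rhs_denominator m d) 1"
  have c: "?c (Suc d) = ?u * ?c d" by (simp only: step_falling_Suc mult_ac)
  have "weight_series m (Suc d) * (1 - ?a * fps_X)
      = fps_const (?c (Suc d)) * fps_X ^ Suc d * (?E (Suc d) * (1 - ?a * fps_X))"
    by (simp only: weight_series_def mult.assoc)
  also have "\<dots> = fps_const ?u * fps_const (?c d) * (fps_X * fps_X ^ d) * ?E d"
    by (simp only: fps_right_inverse_rhs_denominator_Suc c fps_const_mult power_Suc)
  also have "\<dots> = fps_const ?u * fps_X * weight_series m d"
    by (simp only: weight_series_def mult_ac)
  finally have "weight_series m (Suc d) * (1 - ?a * fps_X) = fps_const ?u * fps_X * weight_series m d" .
  then show ?thesis by (simp only: right_diff_distrib diff_eq_eq mult_1_right) (simp only: mult_ac add_ac)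
qed

lemma weight_series_nth: "fps_nth (weight_series m d) n = colour_weight m poly_t n d"
proof (induction n arbitrary: d)
  case 0
  have "fps_nth (weight_series m (Suc e)) 0 = 0" for e
    by (simp add: weight_series_def fps_mult_nth_0)
  moreover have "fps_nth (weight_series m 0) 0 = 1"
    by (simp add: weight_series_def rhs_denominator_def step_falling_def)
  ultimately show ?case by (cases d) auto
next
  case (Suc n)
  show ?case
  proof (cases d)
    case 0
    have "weight_series m 0 = 1"
      using rhs_denominator_right_inverse[of m 0]
      by (simp add: weight_series_def rhs_denominator_def step_falling_def)
    then show ?thesis by (simp add: 0)
  next
    case (Suc e)
    have "fps_nth (weight_series m d) (Suc n)
      = of_nat (m * d) * (poly_t - of_nat (m * d)) * fps_nth (weight_series m d) n +
        (poly_t - of_nat (m * e)) * (poly_t - 1 - of_nat (m * e)) * fps_nth (weight_series m e) n"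
      unfolding Suc
      by (subst weight_series_Suc) (simp only: fps_add_nth mult.assoc fps_mult_left_const_nth fps_X_mult_nth
          nat.simps if_False diff_Suc_1)
    then show ?thesis by (simp add: Suc.IH Suc)
  qed
qed

text \<open>The factor \<open>poly_t\<close> completes the second falling product, which starts at
  \<open>poly_t - of_nat m\<close>, to one starting at \<open>poly_t\<close>.\<close>

lemma rhs_term_nth:
  "poly_t * fps_nth (rhs_term m (Suc d)) n = colour_weight m poly_t n (Suc d)"
proof -
  have "fps_const poly_t * rhs_term m (Suc d) = weight_series m (Suc d)"
    by (simp only: rhs_term_def weight_series_def diff_Suc_1 step_falling_Suc_shift[of poly_t]
        fps_const_mult[symmetric] mult_ac)
  then show ?thesis by (metis fps_mult_left_const_nth weight_series_nth)
qed

section \<open>The homogenized Linial--Dowling arrangement\<close>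

lemma root_of_unity_power: "root_of_unity m ^ l = cis (2 * pi * real l / real m)"
proof -
  have "root_of_unity m = cis (2 * pi / real m)"
    by (simp add: root_of_unity_def cis_conv_exp mult_ac)
  then show ?thesis by (simp add: Complex.DeMoivre mult_ac)
qed

lemma roots_of_unity_iff:
  assumes "m \<ge> 1"
  shows "g ^ m = 1 \<longleftrightarrow> (\<exists>l<m. g = root_of_unity m ^ l)"
proof -
  have "bij_betw (\<lambda>l. root_of_unity m ^ l) {..<m} {g. g ^ m = 1}"
    unfolding root_of_unity_power using assms by (intro bij_betw_roots_unity) auto
  then have "{g. g ^ m = 1} = (\<lambda>l. root_of_unity m ^ l) ` {..<m}" by (simp add: bij_betw_def)
  then show ?thesis by (auto simp: set_eq_iff image_iff)
qed

text \<open>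
  The coordinate \<open>(True, i)\<close> is \<open>x\<^sub>i\<close> and \<open>(False, i)\<close> is \<open>z\<^sub>i = x\<^sub>i - y\<^sub>i\<close>; in these coordinates
  the hyperplanes become \<open>z\<^sub>i = \<omega>\<^sup>l x\<^sub>j\<close> and \<open>z\<^sub>i = 0\<close>.
\<close>

definition xz_coordinate :: "(nat \<Rightarrow> complex) \<times> (nat \<Rightarrow> complex) \<Rightarrow> bool \<times> nat \<Rightarrow> complex" where
  "xz_coordinate p e = (if fst e then fst p (snd e) else fst p (snd e) - snd p (snd e))"

lemma xz_coordinate_simps [simp]:
  "xz_coordinate p (True, i) = fst p i" "xz_coordinate p (False, i) = fst p i - snd p i"
  by (simp_all add: xz_coordinate_def)

lemma bij_betw_xz_coordinate:
  "bij_betw (\<lambda>p. restrict (xz_coordinate p) (UNIV \<times> {1..n})) (complex_space n)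
     (UNIV \<times> {1..n} \<rightarrow>\<^sub>E UNIV)"
proof (rule bij_betw_imageI)
  let ?I = "UNIV \<times> {1..n} :: (bool \<times> nat) set"
  show "inj_on (\<lambda>p. restrict (xz_coordinate p) ?I) (complex_space n)"
  proof (rule inj_onI)
    fix p q assume p: "p \<in> complex_space n" and q: "q \<in> complex_space n"
      and eq: "restrict (xz_coordinate p) ?I = restrict (xz_coordinate q) ?I"
    have c: "xz_coordinate p e = xz_coordinate q e" if "e \<in> ?I" for e
      using fun_cong[OF eq, of e] that by simp
    have "fst p i = fst q i \<and> snd p i = snd q i" if "i \<in> {1..n}" for i
      using c[of "(True, i)"] c[of "(False, i)"] that by simp
    moreover have "fst p \<in> {1..n} \<rightarrow>\<^sub>E UNIV" "fst q \<in> {1..n} \<rightarrow>\<^sub>E UNIV"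
      "snd p \<in> {1..n} \<rightarrow>\<^sub>E UNIV" "snd q \<in> {1..n} \<rightarrow>\<^sub>E UNIV"
      using p q unfolding complex_space_def by (simp_all only: mem_Times_iff)
    ultimately show "p = q" by (intro prod_eqI PiE_ext) blast+
  qed
  show "(\<lambda>p. restrict (xz_coordinate p) ?I) ` complex_space n = ?I \<rightarrow>\<^sub>E UNIV"
  proof (intro equalityI subsetI)
    fix f assume "f \<in> (\<lambda>p. restrict (xz_coordinate p) ?I) ` complex_space n"
    then show "f \<in> ?I \<rightarrow>\<^sub>E UNIV" by (elim imageE) (simp add: PiE_iff)
  next
    fix f :: "bool \<times> nat \<Rightarrow> complex" assume f: "f \<in> ?I \<rightarrow>\<^sub>E UNIV"
    let ?p = "(\<lambda>i\<in>{1..n}. f (True, i), \<lambda>i\<in>{1..n}. f (True, i) - f (False, i))"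
    have "f = restrict (xz_coordinate ?p) ?I"
    proof
      fix e show "f e = restrict (xz_coordinate ?p) ?I e"
        using f by (cases e; cases "fst e") (auto simp: restrict_def PiE_def extensional_def)
    qed
    moreover have "?p \<in> complex_space n" by (auto simp: complex_space_def)
    ultimately show "f \<in> (\<lambda>p. restrict (xz_coordinate p) ?I) ` complex_space n"
      by (rule image_eqI)
  qed
qed

lemma coordinate_space_complex_space:
  assumes m: "m \<ge> 1"
  shows "coordinate_space (complex_space n) (UNIV \<times> {1..n}) xz_coordinate {g. g ^ m = 1}"
proof
  show "bij_betw (\<lambda>p. restrict (xz_coordinate p) (UNIV \<times> {1..n})) (complex_space n)
     (UNIV \<times> {1..n} \<rightarrow>\<^sub>E UNIV)"
    by (rule bij_betw_xz_coordinate)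
  show "finite {g::complex. g ^ m = 1}" using m by (simp add: finite_roots_unity)
  show "finite (UNIV \<times> {1..n} :: (bool \<times> nat) set)" by simp
  show "(0::complex) \<notin> {g. g ^ m = 1}" using m by (simp add: zero_power)
qed (simp_all add: power_mult_distrib power_divide)

lemma in_hom_linial_dowling_iff:
  "H \<in> hom_linial_dowling m n \<longleftrightarrow>
     (\<exists>i j l. 1 \<le> i \<and> i < j \<and> j \<le> n \<and> l < m \<and>
        H = {p \<in> complex_space n. fst p i - snd p i = root_of_unity m ^ l * fst p j}) \<or>
     (\<exists>i. 1 \<le> i \<and> i \<le> n \<and> H = {p \<in> complex_space n. fst p i - snd p i = 0})"
proof -
  have "{(x, y) \<in> complex_space n. x i - a * x j = y i}
      = {p \<in> complex_space n. fst p i - snd p i = a * fst p j}" for i j a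
    by (auto simp: algebra_simps)
  moreover have "{(x, y) \<in> complex_space n. x i = y i} = {p \<in> complex_space n. fst p i - snd p i = 0}" for i
    by auto
  ultimately show ?thesis by (auto simp: hom_linial_dowling_def)
qed

lemma in_Union_hom_linial_dowling_iff:
  assumes p: "p \<in> complex_space n"
  shows "p \<in> \<Union>(hom_linial_dowling m n) \<longleftrightarrow>
     (\<exists>i j l. 1 \<le> i \<and> i < j \<and> j \<le> n \<and> l < m \<and>
        fst p i - snd p i = root_of_unity m ^ l * fst p j) \<or>
     (\<exists>i. 1 \<le> i \<and> i \<le> n \<and> fst p i - snd p i = 0)" (is "_ \<longleftrightarrow> ?R")
proof
  assume "p \<in> \<Union>(hom_linial_dowling m n)"
  then obtain H where H: "H \<in> hom_linial_dowling m n" "p \<in> H" by blast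
  from H(1)[unfolded in_hom_linial_dowling_iff] H(2) show ?R by blast
next
  assume ?R
  then show "p \<in> \<Union>(hom_linial_dowling m n)"
  proof (elim disjE exE conjE)
    fix i j l assume ij: "1 \<le> i" "i < j" "j \<le> n" "l < m"
      and eq: "fst p i - snd p i = root_of_unity m ^ l * fst p j"
    have "{p \<in> complex_space n. fst p i - snd p i = root_of_unity m ^ l * fst p j}
        \<in> hom_linial_dowling m n"
      unfolding in_hom_linial_dowling_iff using ij by blast
    then show ?thesis using p eq by blast
  next
    fix i assume i: "1 \<le> i" "i \<le> n" and eq: "fst p i - snd p i = 0"
    have "{p \<in> complex_space n. fst p i - snd p i = 0} \<in> hom_linial_dowling m n"
      unfolding in_hom_linial_dowling_iff using i by blast
    then show ?thesis using p eq by blast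
  qed
qed

lemma finite_hom_linial_dowling: "finite (hom_linial_dowling m n)"
proof -
  have "hom_linial_dowling m n \<subseteq>
      (\<lambda>(i, j, l). {p \<in> complex_space n. fst p i - snd p i = root_of_unity m ^ l * fst p j}) `
        ({..n} \<times> {..n} \<times> {..m}) \<union>
      (\<lambda>i. {p \<in> complex_space n. fst p i - snd p i = 0}) ` {..n}"
  proof
    fix H assume "H \<in> hom_linial_dowling m n"
    then consider i j l where "1 \<le> i" "i < j" "j \<le> n" "l < m"
      "H = {p \<in> complex_space n. fst p i - snd p i = root_of_unity m ^ l * fst p j}"
      | i where "1 \<le> i" "i \<le> n" "H = {p \<in> complex_space n. fst p i - snd p i = 0}"
      unfolding in_hom_linial_dowling_iff by blast
    then show "H \<in> (\<lambda>(i, j, l). {p \<in> complex_space n. fst p i - snd p i = root_of_unity m ^ l * fst p j}) `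
        ({..n} \<times> {..n} \<times> {..m}) \<union>
      (\<lambda>i. {p \<in> complex_space n. fst p i - snd p i = 0}) ` {..n}"
    proof cases
      case 1
      then show ?thesis by (intro UnI1 image_eqI[of _ _ "(i, j, l)"]) auto
    next
      case 2
      then show ?thesis by (intro UnI2 image_eqI[of _ _ i]) auto
    qed
  qed
  then show ?thesis by (rule finite_subset) simp
qed

text \<open>Once all z-values vanish, the remaining equations kill x_j for every j that has a
  smaller index i, that is, for all j except 1.\<close>

lemma center_hom_linial_dowling:
  assumes m: "m \<ge> 1"
  shows "complex_space n \<inter> \<Inter>(hom_linial_dowling m n) =
    {p \<in> complex_space n. \<forall>i\<in>{1..n}. fst p i - snd p i = 0 \<and> (i \<noteq> 1 \<longrightarrow> fst p i = 0)}"
proof (intro equalityI subsetI)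
  fix p assume "p \<in> complex_space n \<inter> \<Inter>(hom_linial_dowling m n)"
  then have p: "p \<in> complex_space n" and pH: "\<And>H. H \<in> hom_linial_dowling m n \<Longrightarrow> p \<in> H" by auto
  have z: "fst p i - snd p i = 0" if "i \<in> {1..n}" for i
    using pH[of "{p \<in> complex_space n. fst p i - snd p i = 0}"] that
    unfolding in_hom_linial_dowling_iff by auto
  have "fst p i = 0" if i: "i \<in> {1..n}" "i \<noteq> 1" for i
  proof -
    \<comment> \<open>The exponent 0 is admissible as \<open>m\<close> is positive, and z_1 = 0 then
      forces x_i = 0.\<close>
    have "{p \<in> complex_space n. fst p 1 - snd p 1 = root_of_unity m ^ 0 * fst p i}
        \<in> hom_linial_dowling m n"
      unfolding in_hom_linial_dowling_iff using i m
      by (intro disjI1 exI[of _ 1] exI[of _ i] exI[of _ 0]) auto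
    from pH[OF this] show ?thesis using z[of 1] i by auto
  qed
  with p z show "p \<in> {p \<in> complex_space n.
      \<forall>i\<in>{1..n}. fst p i - snd p i = 0 \<and> (i \<noteq> 1 \<longrightarrow> fst p i = 0)}"
    by blast
next
  fix p assume p: "p \<in> {p \<in> complex_space n.
      \<forall>i\<in>{1..n}. fst p i - snd p i = 0 \<and> (i \<noteq> 1 \<longrightarrow> fst p i = 0)}"
  then have z: "fst p i - snd p i = 0" if "1 \<le> i" "i \<le> n" for i
    using that by simp
  have x: "fst p j = 0" if "1 \<le> i" "i < j" "j \<le> n" for i j
  proof -
    have "j \<in> {1..n}" "j \<noteq> 1" using that by auto
    then show ?thesis using p by blast
  qed
  have "p \<in> H" if H: "H \<in> hom_linial_dowling m n" for H
    using H[unfolded in_hom_linial_dowling_iff]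
  proof (elim disjE exE conjE)
    fix i j l assume "1 \<le> i" "i < j" "j \<le> n"
      "H = {p \<in> complex_space n. fst p i - snd p i = root_of_unity m ^ l * fst p j}"
    then show "p \<in> H" using p z[of i] x[of i j] by simp
  next
    fix i assume "1 \<le> i" "i \<le> n" "H = {p \<in> complex_space n. fst p i - snd p i = 0}"
    then show "p \<in> H" using p z[of i] by simp
  qed
  with p show "p \<in> complex_space n \<inter> \<Inter>(hom_linial_dowling m n)" by blast
qed

text \<open>The exponent in \<open>char_poly_grid\<close> is 1, the dimension of the center. On the
  grid, avoiding the \<open>m\<close> hyperplanes of a pair i < j is one inequality of norms, which
  yields the proper colourings.\<close>

lemma poly_arr_char_poly_hom_linial_dowling:
  fixes m n k :: nat
  assumes m: "m \<ge> 1" and n: "n \<ge> 1"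
  defines "S \<equiv> polar_grid m k"
  shows "int (card S) * poly (arr_char_poly (complex_space n) (hom_linial_dowling m n)) (int (card S))
    = int (card (proper_colourings S n))"
proof -
  let ?I = "UNIV \<times> {1..n} :: (bool \<times> nat) set" and ?G = "{g::complex. g ^ m = 1}"
  let ?\<A> = "hom_linial_dowling m n"
  interpret coordinate_space "complex_space n" ?I xz_coordinate ?G
    by (rule coordinate_space_complex_space[OF m])
  have hyp: "gain_hyperplane H" if H: "H \<in> ?\<A>" for H
  proof -
    from H consider i j l where "1 \<le> i" "i < j" "j \<le> n" "l < m"
      "H = {p \<in> complex_space n. fst p i - snd p i = root_of_unity m ^ l * fst p j}"
      | i where "1 \<le> i" "i \<le> n" "H = {p \<in> complex_space n. fst p i - snd p i = 0}"
      unfolding in_hom_linial_dowling_iff by blast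
    then show ?thesis
    proof cases
      case 1
      then have "(root_of_unity m ^ l) ^ m = 1" using roots_of_unity_iff[OF m] by blast
      with 1 show ?thesis unfolding gain_hyperplane_def
        by (intro bexI[of _ "(False, i)"] bexI[of _ "(True, j)"] bexI[of _ "root_of_unity m ^ l"]) auto
    next
      case 2
      \<comment> \<open>The equation z_i = 0 has gain 0, so its second coordinate is
        arbitrary.\<close>
      then show ?thesis unfolding gain_hyperplane_def
        by (intro bexI[of _ "(False, i)"] bexI[of _ "(False, i)"] bexI[of _ 0]) auto
    qed
  qed
  have "gain_subspace {(True, 1)} (\<lambda>_. (True, 1)) (\<lambda>e. if e = (True, 1) then 1 else 0)
      (complex_space n \<inter> \<Inter>?\<A>)"
    unfolding gain_subspace_def center_hom_linial_dowling[OF m]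
    using n by (auto simp: all_bool_eq split: if_splits)
  then have dim: "has_dim (complex_space n \<inter> \<Inter>?\<A>) 1"
    unfolding has_dim_def by (intro exI conjI) auto
  \<comment> \<open>Since z = x - y and y = x - z, the map is its own inverse.\<close>
  have "bij_betw (\<lambda>p. (fst p, \<lambda>i\<in>{1..n}. fst p i - snd p i)) (grid S - \<Union>?\<A>) (proper_colourings S n)"
  proof (rule bij_betw_byWitness[where f' = "\<lambda>p. (fst p, \<lambda>i\<in>{1..n}. fst p i - snd p i)"])
    let ?f = "\<lambda>p. (fst p, \<lambda>i\<in>{1..n}. fst p i - snd p i :: complex)"
    have invol: "?f (?f p) = p" if "snd p \<in> extensional {1..n}" for p
      using that by (intro prod_eqI) (auto simp: restrict_def extensional_def fun_eq_iff)
    have sub: "grid S \<subseteq> complex_space n" unfolding grid_def by blast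
    have ext: "snd p \<in> extensional {1..n}" if "p \<in> complex_space n" for p
      using that by (auto simp: complex_space_def PiE_def)
    show "\<forall>p\<in>grid S - \<Union>?\<A>. ?f (?f p) = p"
      using invol sub ext by blast
    show "\<forall>p\<in>proper_colourings S n. ?f (?f p) = p"
      using invol by (auto simp: proper_colourings_def PiE_def)
    have key: "?f p \<in> proper_colourings S n \<longleftrightarrow> p \<in> grid S - \<Union>?\<A>" if p: "p \<in> complex_space n" for p
    proof -
      have px: "fst p \<in> extensional {1..n}" using p by (auto simp: complex_space_def PiE_def)
      have grid: "p \<in> grid S \<longleftrightarrow> (\<forall>i\<in>{1..n}. fst p i \<in> S \<and> fst p i - snd p i \<in> S)"
        unfolding grid_def using p by (auto simp: all_bool_eq)
      have iff: "norm (fst p i - snd p i) \<noteq> norm (fst p j) \<longleftrightarrow>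
          (\<forall>l<m. fst p i - snd p i \<noteq> root_of_unity m ^ l * fst p j)"
        if "p \<in> grid S" "i \<in> {1..n}" "j \<in> {1..n}" "fst p i - snd p i \<noteq> 0" for i j
        using norm_eq_polar_grid_iff[OF m, of "fst p i - snd p i" k "fst p j"] that grid
        unfolding S_def roots_of_unity_iff[OF m] by auto
      have off: "p \<notin> \<Union>?\<A> \<longleftrightarrow> (\<forall>i\<in>{1..n}. fst p i - snd p i \<noteq> 0) \<and>
        (\<forall>i j. 1 \<le> i \<and> i < j \<and> j \<le> n \<longrightarrow>
          (\<forall>l<m. fst p i - snd p i \<noteq> root_of_unity m ^ l * fst p j))"
        unfolding in_Union_hom_linial_dowling_iff[OF p] by (simp add: Ball_def) blast
      have "p \<notin> \<Union>?\<A> \<longleftrightarrow> (\<forall>i\<in>{1..n}. fst p i - snd p i \<noteq> 0) \<and>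
        (\<forall>i j. 1 \<le> i \<and> i < j \<and> j \<le> n \<longrightarrow> norm (fst p i - snd p i) \<noteq> norm (fst p j))"
        if g: "p \<in> grid S"
        unfolding off
      proof (intro conj_cong refl all_cong1 imp_cong)
        fix i j assume "\<forall>i\<in>{1..n}. fst p i - snd p i \<noteq> 0" "1 \<le> i \<and> i < j \<and> j \<le> n"
        then show "(\<forall>l<m. fst p i - snd p i \<noteq> root_of_unity m ^ l * fst p j) \<longleftrightarrow>
            norm (fst p i - snd p i) \<noteq> norm (fst p j)"
          by (intro iff[OF g, symmetric]) auto
      qed
      moreover have "?f p \<in> proper_colourings S n \<longleftrightarrow> p \<in> grid S \<and>
        (\<forall>i\<in>{1..n}. fst p i - snd p i \<noteq> 0) \<and>
        (\<forall>i j. 1 \<le> i \<and> i < j \<and> j \<le> n \<longrightarrow> norm (fst p i - snd p i) \<noteq> norm (fst p j))"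
        unfolding grid using px by (auto simp: proper_colourings_def PiE_iff)
      ultimately show ?thesis by blast
    qed
    show "?f ` (grid S - \<Union>?\<A>) \<subseteq> proper_colourings S n"
      using key sub by blast
    show "?f ` proper_colourings S n \<subseteq> grid S - \<Union>?\<A>"
    proof
      fix q assume "q \<in> ?f ` proper_colourings S n"
      then obtain p where p: "p \<in> proper_colourings S n" "q = ?f p" by blast
      then have "q \<in> complex_space n"
        by (auto simp: proper_colourings_def complex_space_def PiE_def)
      moreover have "?f q = p" using p invol by (auto simp: proper_colourings_def PiE_def)
      ultimately show "q \<in> grid S - \<Union>?\<A>" using p(1) by (simp only: key[symmetric])
    qed
  qed
  then have "card (grid S - \<Union>?\<A>) = card (proper_colourings S n)" by (rule bij_betw_same_card)
  moreover have "int (card S) ^ 1 * poly (arr_char_poly (complex_space n) ?\<A>) (int (card S))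
      = int (card (grid S - \<Union>?\<A>))"
    using finite_hom_linial_dowling hyp dim
  proof (rule char_poly_grid)
    show "finite S" "0 \<in> S" unfolding S_def using m by (simp_all add: finite_polar_grid zero_in_polar_grid)
    show "g * s \<in> S" if "g \<in> ?G" "s \<in> S" for g s
      using that mult_in_polar_grid unfolding S_def by blast
  qed
  ultimately show ?thesis by simp
qed

text \<open>The summands with index above \<open>n\<close> are divisible by a higher power of x, so
  the coefficient is this finite sum. The common factor q = mk + 1 is nonzero and cancels.\<close>

lemma arr_char_poly_hom_linial_dowling:
  assumes m: "m \<ge> 1" and n: "n \<ge> 1"
  shows "arr_char_poly (complex_space n) (hom_linial_dowling m n) =
    (\<Sum>d<n. fps_nth (rhs_term m (Suc d)) n)"
    (is "?\<chi> = ?R")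
proof -
  have "poly ?\<chi> (int (m * k + 1)) = poly ?R (int (m * k + 1))" for k
  proof -
    let ?q = "int (m * k + 1)"
    \<comment> \<open>A colouring of at least one pair uses at least one modulus, which removes d =
      0.\<close>
    have w0: "colour_weight m ?q n 0 = 0" using n by (cases n) auto
    have "?q * poly ?\<chi> ?q = (\<Sum>d\<le>n. colour_weight m ?q n d)"
      using poly_arr_char_poly_hom_linial_dowling[OF m n, of k]
      by (simp only: card_polar_grid[OF m] card_proper_colourings[OF m])
    also have "\<dots> = (\<Sum>d<n. colour_weight m ?q n (Suc d))"
      using w0 by (simp add: lessThan_Suc_atMost[symmetric] sum.lessThan_Suc_shift del: sum.lessThan_Suc)
    also have "\<dots> = (\<Sum>d<n. poly (poly_t * fps_nth (rhs_term m (Suc d)) n) ?q)"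
      by (simp only: rhs_term_nth poly_colour_weight) simp
    also have "\<dots> = ?q * poly ?R ?q"
      by (simp add: poly_sum sum_distrib_left)
    finally show ?thesis by (simp del: of_nat_add of_nat_mult)
  qed
  then have "range (\<lambda>k. int (m * k + 1)) \<subseteq> {a. poly (?\<chi> - ?R) a = 0}" by auto
  moreover have "infinite (range (\<lambda>k. int (m * k + 1)))"
    using m by (intro range_inj_infinite) (auto simp: inj_def)
  ultimately have "infinite {a. poly (?\<chi> - ?R) a = 0}" using finite_subset by blast
  then have "?\<chi> - ?R = 0" using poly_roots_finite by blast
  then show ?thesis by simp
qed

text \<open>Convergence of formal power series is coefficientwise, and each coefficient of the
  partial sums is eventually constant. The shift by \<open>Suc\<close> makes the series start at
  index 1.\<close>

theorem theorem4p4: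
  fixes m :: nat
  assumes "m \<ge> 1"
  shows "(\<lambda>n. rhs_term m (Suc n)) sums
           Abs_fps (\<lambda>n. if n \<ge> 1 then arr_char_poly (complex_space n) (hom_linial_dowling m n) else 0)"
  unfolding sums_def
proof (rule tendsto_fpsI)
  fix n
  have zero: "fps_nth (rhs_term m (Suc d)) n = 0" if "n \<le> d" for d
  proof -
    \<comment> \<open>The factor \<open>poly_t\<close> is nonzero and cancels in the integral domain
      of integer polynomials.\<close>
    have "poly_t * fps_nth (rhs_term m (Suc d)) n = 0"
      using that by (simp only: rhs_term_nth) (simp add: colour_weight_eq_0)
    then show ?thesis by simp
  qed
  have sum: "fps_nth (\<Sum>d<N. rhs_term m (Suc d)) n = (\<Sum>d<n. fps_nth (rhs_term m (Suc d)) n)" if "n \<le> N" for N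
    unfolding fps_sum_nth using that zero by (intro sum.mono_neutral_right) auto
  have "(\<Sum>d<n. fps_nth (rhs_term m (Suc d)) n)
      = (if n \<ge> 1 then arr_char_poly (complex_space n) (hom_linial_dowling m n) else 0)"
    using arr_char_poly_hom_linial_dowling[OF assms, of n] by (cases n) auto
  then show "\<forall>\<^sub>F N in sequentially. fps_nth (\<Sum>d<N. rhs_term m (Suc d)) n =
      fps_nth (Abs_fps (\<lambda>n. if n \<ge> 1 then arr_char_poly (complex_space n) (hom_linial_dowling m n) else 0)) n"
    by (intro eventually_mono[OF eventually_ge_at_top[of n]]) (simp only: sum fps_nth_Abs_fps)
qed

end
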